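(* Let $f:\{0,1\}^n\times\{0,1\}^n\to\{\pm1\}$ be the Inner Product function over $\mathbb{F}_2$, $f(s,x)=(-1)^{\langle s,x\rangle}$, and consider the Multiphase Problem for $f$ with $m=n^{1+c}$ for a constant $c>0$. Let $\kappa>0$ be any (large) constant. Then every cell-probe data structure for this problem with update time $t_u\le \log^{\kappa} n$ has total query time $$t_{tot}\ \ge\ \Omega\!\left(\left(\frac{\log n}{\log\log n}\right)^2\right).$$
   Context: Cell-probe model: memory consists of cells of $w=\Theta(\log n)$ bits; an algorithm is charged one unit per cell it reads or writes (a probe), and all computation on probed data is free. Multiphase Problem for $f$: first, $\vec S=(S_1,\dots,S_m)\in(\{0,1\}^n)^m$ is given and preprocessed (preprocessing is free). Then $X\in\{0,1\}^n$ is given as a sequence of $n$ updates (one per bit), each update handled with at most $t_u$ probes. Finally a query $q\in[m]$ is given and the data structure must output $f(S_q,X)$ correctly using at most $t_{tot}$ probes in total. *)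

theory Defs
  imports Complex_Main "HOL-Library.Landau_Symbols"
begin

definition bitvecs :: "nat \<Rightarrow> bool list set" where
  "bitvecs n = {x. length x = n}"

definition ip_sign :: "bool list \<Rightarrow> bool list \<Rightarrow> int" where
  "ip_sign s x = (-1) ^ ((\<Sum>i<length s. of_bool (s ! i) * of_bool (x ! i) :: nat) mod 2)"

type_synonym memory = "nat \<Rightarrow> bool list"

definition word_memory :: "nat \<Rightarrow> memory \<Rightarrow> bool" where
  "word_memory w M \<longleftrightarrow> (\<forall>a. M a \<in> bitvecs w)"

text \<open>
  An algorithm is an adaptive decision tree over memory accesses. Computation on what has been
  read is free, because the continuation of a read is an arbitrary function. An algorithm has no
  access to its environment (and keeps no state between calls) except through the cells it probes.
\<close>

datatype 'r probe_alg =
    Return 'r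
  | Read nat "bool list \<Rightarrow> 'r probe_alg"
  | Write nat "bool list" "'r probe_alg"

primrec result :: "'r probe_alg \<Rightarrow> memory \<Rightarrow> 'r" where
  "result (Return r) M = r"
| "result (Read a k) M = result (k (M a)) M"
| "result (Write a v A) M = result A (M(a := v))"

primrec final_memory :: "'r probe_alg \<Rightarrow> memory \<Rightarrow> memory" where
  "final_memory (Return r) M = M"
| "final_memory (Read a k) M = final_memory (k (M a)) M"
| "final_memory (Write a v A) M = final_memory A (M(a := v))"

primrec probes :: "'r probe_alg \<Rightarrow> memory \<Rightarrow> nat" where
  "probes (Return r) M = 0"
| "probes (Read a k) M = Suc (probes (k (M a)) M)"
| "probes (Write a v A) M = Suc (probes A (M(a := v)))"

primrec writes_words :: "nat \<Rightarrow> 'r probe_alg \<Rightarrow> bool" where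
  "writes_words w (Return r) \<longleftrightarrow> True"
| "writes_words w (Read a k) \<longleftrightarrow> (\<forall>v. v \<in> bitvecs w \<longrightarrow> writes_words w (k v))"
| "writes_words w (Write a v A) \<longleftrightarrow> v \<in> bitvecs w \<and> writes_words w A"

text \<open>
  The vectors \<open>S\<close> enter only through the preprocessed memory. Update number \<open>i\<close> is told its
  position \<open>i\<close> and the bit \<open>X ! i\<close>; the query algorithm is told only the index \<open>q\<close>.
\<close>

record multiphase_ds =
  preprocess :: "bool list list \<Rightarrow> memory"
  update :: "nat \<Rightarrow> bool \<Rightarrow> unit probe_alg"
  query :: "nat \<Rightarrow> int probe_alg"

definition word_ds :: "nat \<Rightarrow> multiphase_ds \<Rightarrow> bool" where
  "word_ds w D \<longleftrightarrow>
     (\<forall>S. word_memory w (preprocess D S)) \<and>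
     (\<forall>i b. writes_words w (update D i b)) \<and>
     (\<forall>q. writes_words w (query D q))"

primrec memory_after :: "multiphase_ds \<Rightarrow> bool list list \<Rightarrow> bool list \<Rightarrow> nat \<Rightarrow> memory" where
  "memory_after D S X 0 = preprocess D S"
| "memory_after D S X (Suc i) = final_memory (update D i (X ! i)) (memory_after D S X i)"

definition solves_multiphase ::
  "(bool list \<Rightarrow> bool list \<Rightarrow> int) \<Rightarrow> nat \<Rightarrow> nat \<Rightarrow> nat \<Rightarrow> nat \<Rightarrow> nat \<Rightarrow> multiphase_ds \<Rightarrow> bool" where
  "solves_multiphase f n m w t\<^sub>u t\<^sub>t\<^sub>o\<^sub>t D \<longleftrightarrow>
     word_ds w D \<and>
     (\<forall>S X. length S = m \<longrightarrow> set S \<subseteq> bitvecs n \<longrightarrow> X \<in> bitvecs n \<longrightarrow>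
        (\<forall>i<n. probes (update D i (X ! i)) (memory_after D S X i) \<le> t\<^sub>u) \<and>
        (\<forall>q<m. result (query D q) (memory_after D S X n) = f (S ! q) X \<and>
               probes (query D q) (memory_after D S X n) \<le> t\<^sub>t\<^sub>o\<^sub>t))"

end

theory Submission
  imports Defs "HOL-Library.FuncSet" "HOL-Real_Asymp.Real_Asymp"
begin

text \<open>
  Split the updates into \<open>K = \<Theta>(log n / log log n)\<close> epochs, counted from the end, whose lengths grow
  by a polylogarithmic factor, and charge a probed cell to the last epoch that wrote it. If the
  query time were a small multiple of \<open>(log n / log log n)\<^sup>2\<close>, some epoch would be charged only a
  small multiple \<open>h\<close> of \<open>log n / log log n\<close> probes by an average query. Publishing a polylogarithmic fraction of
  the cells charged to that epoch, together with all cells written later, takes fewer bits than the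
  length of the epoch and still covers all charged cells of a fraction \<open>1 / polylog(n)\<^sup>h = n\<^sup>-\<^sup>\<delta>\<close> of
  the queries.

  Without knowing the updates of the epoch, one can run every query on the old memory overridden by
  the published cells. The run may be wrong, because it does not know which further cells have been
  overwritten. But someone who knows the set \<open>V\<close> of unpublished overwritten cells can discard the
  queries that touch \<open>V\<close>, and the answers that survive are correct. So if \<open>\<alpha>\<^sub>q\<close> is the outcome of
  the run of query \<open>q\<close>, a table \<open>\<beta>\<^sub>V(\<alpha>\<^sub>q)\<close> that depends on \<open>V\<close> only correlates with \<open>f(S\<^sub>q, X)\<close>,
  and by pigeonhole the same \<open>\<alpha>\<close> serves many, hence \<open>N = n\<^sup>3\<^sup>\<delta>\<close> linearly independent, vectors \<open>X\<close>.
  For random \<open>S\<close> this is impossible: the \<open>N m\<close> signs are independent, so that a fixed choice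
  correlates with probability at most \<open>exp(- N m n\<^sup>-\<^sup>2\<^sup>\<delta> / 16)\<close>, which beats a union bound
  over \<open>\<alpha>\<close>, of \<open>m polylog(n)\<close> bits (because \<open>N\<close> is much larger than \<open>n\<^sup>2\<^sup>\<delta>\<close>), and over the \<open>N\<close> sets
  \<open>V\<close>, of \<open>n polylog(n)\<close> bits each (because \<open>m\<close> is much larger than \<open>n\<^sup>1\<^sup>+\<^sup>2\<^sup>\<delta>\<close>).
\<close>

lemma finite_bitvecs: "finite (bitvecs n)" and card_bitvecs: "card (bitvecs n) = 2 ^ n"
proof -
  have *: "bitvecs n = {xs. set xs \<subseteq> UNIV \<and> length xs = n}"
    by (auto simp: bitvecs_def)
  show "finite (bitvecs n)"
    unfolding * by (rule finite_lists_length_eq) simp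
  show "card (bitvecs n) = 2 ^ n"
    unfolding * by (subst card_lists_length_eq) (simp_all add: card_UNIV_bool)
qed

section \<open>Probed and written cells\<close>

primrec probed :: "'r probe_alg \<Rightarrow> memory \<Rightarrow> nat set" where
  "probed (Return r) M = {}"
| "probed (Read a k) M = insert a (probed (k (M a)) M)"
| "probed (Write a v A) M = insert a (probed A (M(a := v)))"

primrec written :: "'r probe_alg \<Rightarrow> memory \<Rightarrow> nat set" where
  "written (Return r) M = {}"
| "written (Read a k) M = written (k (M a)) M"
| "written (Write a v A) M = insert a (written A (M(a := v)))"

lemma finite_probed: "finite (probed A M)"
  by (induction A arbitrary: M) auto

lemma card_probed: "card (probed A M) \<le> probes A M"
proof (induction A arbitrary: M)
  case (Read a k)
  have "card (probed (k (M a)) M) \<le> probes (k (M a)) M"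
    using Read by blast
  then show ?case
    by (simp add: card_insert_if finite_probed)
next
  case (Write a v A)
  have "card (probed A (M(a := v))) \<le> probes A (M(a := v))"
    by (rule Write)
  then show ?case
    by (simp add: card_insert_if finite_probed)
qed simp

lemma finite_written: "finite (written A M)"
  by (induction A arbitrary: M) auto

lemma card_written: "card (written A M) \<le> probes A M"
proof (induction A arbitrary: M)
  case (Read a k)
  have "card (written (k (M a)) M) \<le> probes (k (M a)) M"
    using Read by blast
  then show ?case
    by simp
next
  case (Write a v A)
  have "card (written A (M(a := v))) \<le> probes A (M(a := v))"
    by (rule Write)
  then show ?case
    by (simp add: card_insert_if finite_written)
qed simp

lemma final_memory_unwritten: "a \<notin> written A M \<Longrightarrow> final_memory A M a = M a"
proof (induction A arbitrary: M)
  case (Write b v A)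
  have "final_memory A (M(b := v)) a = (M(b := v)) a"
  proof (rule Write.IH)
    show "a \<notin> written A (M(b := v))"
      using Write.prems by simp
  qed
  then show ?case
    using Write.prems by simp
qed auto

lemma word_memory_upd: "word_memory w M \<Longrightarrow> v \<in> bitvecs w \<Longrightarrow> word_memory w (M(a := v))"
  by (simp add: word_memory_def)

lemma word_memory_final:
  "writes_words w A \<Longrightarrow> word_memory w M \<Longrightarrow> word_memory w (final_memory A M)"
proof (induction A arbitrary: M)
  case (Read a k)
  then show ?case by (simp add: word_memory_def)
qed (simp_all add: word_memory_upd)

text \<open>Agreement is required only along the run on \<open>M\<close>, while the conclusion
  speaks of both runs. Hence it can be applied later from the true memory to the simulated one and
  also backwards.\<close>

lemma probed_cong:
  assumes "\<And>a. a \<in> probed A M \<Longrightarrow> M' a = M a"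
  shows "probed A M' = probed A M \<and> result A M' = result A M \<and> probes A M' = probes A M"
  using assms
proof (induction A arbitrary: M M')
  case (Read a k)
  have "M' a = M a"
    using Read.prems by simp
  moreover have "probed (k (M a)) M' = probed (k (M a)) M \<and>
      result (k (M a)) M' = result (k (M a)) M \<and> probes (k (M a)) M' = probes (k (M a)) M"
    by (rule Read.IH) (use Read.prems in auto)
  ultimately show ?case
    by simp
next
  case (Write a v A)
  have "probed A (M'(a := v)) = probed A (M(a := v)) \<and>
      result A (M'(a := v)) = result A (M(a := v)) \<and> probes A (M'(a := v)) = probes A (M(a := v))"
  proof (rule Write.IH)
    fix b assume "b \<in> probed A (M(a := v))"
    then show "(M'(a := v)) b = (M(a := v)) b"
      using Write.prems by simp
  qed
  then show ?case
    by simp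
qed simp

text \<open>
  Addresses are unbounded, but the cells a query can reach are determined by the words it reads.
  Counting outcomes is therefore what makes addresses cost only polylogarithmically many bits.
\<close>

definition outcomes :: "nat \<Rightarrow> nat \<Rightarrow> 'r probe_alg \<Rightarrow> (nat set \<times> 'r) set" where
  "outcomes w t A = {(probed A M, result A M) | M. word_memory w M \<and> probes A M \<le> t}"

lemma outcomesI:
  "word_memory w M \<Longrightarrow> probes A M \<le> t \<Longrightarrow> (probed A M, result A M) \<in> outcomes w t A"
  by (auto simp: outcomes_def)

text \<open>A run is determined by the words it reads: a read branches into \<open>2 ^ w\<close>
  continuations with one probe less to spend, a write does not branch. The address of the first
  probe is common to all runs, so inserting it creates no further outcomes.\<close>

lemma card_outcomes:
  "writes_words w A \<Longrightarrow> finite (outcomes w t A) \<and> card (outcomes w t A) \<le> 2 ^ (w * t)"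
proof (induction A arbitrary: t)
  case (Return r)
  have "outcomes w t (Return r) \<subseteq> {({}, r)}"
    by (auto simp: outcomes_def)
  then have "finite (outcomes w t (Return r))" "card (outcomes w t (Return r)) \<le> 1"
    by (auto dest: finite_subset card_mono[rotated])
  moreover have "(1::nat) \<le> 2 ^ (w * t)"
    by simp
  ultimately show ?case
    using le_trans by blast
next
  case (Read a k)
  show ?case
  proof (cases t)
    case 0
    then show ?thesis by (simp add: outcomes_def)
  next
    case (Suc u)
    let ?f = "\<lambda>(P, r). (insert a P, r)"
    let ?U = "\<Union>v\<in>bitvecs w. ?f ` outcomes w u (k v)"
    have IH: "finite (outcomes w u (k v)) \<and> card (outcomes w u (k v)) \<le> 2 ^ (w * u)"
      if "v \<in> bitvecs w" for v
      using Read that by simp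
    have sub: "outcomes w t (Read a k) \<subseteq> ?U"
    proof
      fix z assume "z \<in> outcomes w t (Read a k)"
      then obtain M where M: "word_memory w M" "probes (Read a k) M \<le> t"
          and z: "z = (probed (Read a k) M, result (Read a k) M)"
        by (auto simp: outcomes_def)
      have "(probed (k (M a)) M, result (k (M a)) M) \<in> outcomes w u (k (M a))"
        by (rule outcomesI) (use M Suc in auto)
      moreover have "M a \<in> bitvecs w"
        using M by (simp add: word_memory_def)
      moreover have "z = ?f (probed (k (M a)) M, result (k (M a)) M)"
        using z by simp
      ultimately show "z \<in> ?U"
        by blast
    qed
    have fin: "finite ?U"
      using IH finite_bitvecs by blast
    have "card ?U \<le> (\<Sum>v\<in>bitvecs w. card (?f ` outcomes w u (k v)))"
      by (rule card_UN_le) (rule finite_bitvecs)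
    also have "\<dots> \<le> (\<Sum>v\<in>bitvecs w. 2 ^ (w * u))"
      by (rule sum_mono) (meson IH card_image_le le_trans)
    also have "\<dots> = 2 ^ (w * t)"
      by (simp add: card_bitvecs Suc power_add)
    finally show ?thesis
      using sub fin by (meson card_mono finite_subset le_trans)
  qed
next
  case (Write a v A)
  show ?case
  proof (cases t)
    case 0
    then show ?thesis by (simp add: outcomes_def)
  next
    case (Suc u)
    let ?f = "\<lambda>(P, r). (insert a P, r)"
    have IH: "finite (outcomes w u A)" "card (outcomes w u A) \<le> 2 ^ (w * u)"
      using Write by simp_all
    have sub: "outcomes w t (Write a v A) \<subseteq> ?f ` outcomes w u A"
    proof
      fix z assume "z \<in> outcomes w t (Write a v A)"
      then obtain M where M: "word_memory w M" "probes (Write a v A) M \<le> t"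
          and z: "z = (probed (Write a v A) M, result (Write a v A) M)"
        by (auto simp: outcomes_def)
      have "(probed A (M(a := v)), result A (M(a := v))) \<in> outcomes w u A"
        by (rule outcomesI) (use M Suc Write.prems word_memory_upd in auto)
      moreover have "z = ?f (probed A (M(a := v)), result A (M(a := v)))"
        using z by simp
      ultimately show "z \<in> ?f ` outcomes w u A"
        by blast
    qed
    have "card (?f ` outcomes w u A) \<le> 2 ^ (w * u)"
      using IH card_image_le le_trans by blast
    also have "\<dots> \<le> 2 ^ (w * t)"
      by (simp add: Suc)
    finally show ?thesis
      using sub IH(1) by (meson card_mono finite_imageI finite_subset le_trans)
  qed
qed

section \<open>Characters at independent points\<close>

text \<open>Linear independence over the two-element field.\<close>

definition parity_independent :: "nat \<Rightarrow> nat \<Rightarrow> (nat \<Rightarrow> bool list) \<Rightarrow> bool" where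
  "parity_independent n N X \<longleftrightarrow>
     (\<forall>B\<subseteq>{..<N}. B \<noteq> {} \<longrightarrow> (\<exists>i<n. odd (card {k \<in> B. X k ! i})))"

text \<open>Greedy choice: the first \<open>N\<close> vectors have at most \<open>2 ^ N\<close>
  subset sums \<open>?p B\<close>, so some member of \<X> is none of them. A set \<open>B\<close>
  with only even parities would have to contain this new vector and exhibit it as the sum of the
  others.\<close>

lemma exists_parity_independent:
  assumes "\<X> \<subseteq> bitvecs n" and "2 ^ N < card \<X>"
  shows "\<exists>X. (\<forall>k<N. X k \<in> \<X>) \<and> parity_independent n N X"
  using assms(2)
proof (induction N)
  case 0
  then show ?case by (auto simp: parity_independent_def)
next
  case (Suc N)
  then obtain X where X: "\<And>k. k < N \<Longrightarrow> X k \<in> \<X>" and ind: "parity_independent n N X"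
    by auto
  let ?p = "\<lambda>B. map (\<lambda>i. odd (card {k \<in> B. X k ! i})) [0..<n]"
  have "card (?p ` Pow {..<N}) \<le> card (Pow {..<N})"
    by (rule card_image_le) simp
  also have "\<dots> < card \<X>"
    using Suc.prems by (simp add: card_Pow)
  finally have "\<not> \<X> \<subseteq> ?p ` Pow {..<N}"
    by (meson card_mono finite_Pow_iff finite_imageI finite_lessThan leD)
  then obtain x where x: "x \<in> \<X>" and xn: "x \<notin> ?p ` Pow {..<N}"
    by blast
  let ?X = "X(N := x)"
  have "\<exists>i<n. odd (card {k \<in> B. ?X k ! i})" if B: "B \<subseteq> {..<Suc N}" "B \<noteq> {}" for B
  proof (cases "N \<in> B")
    case False
    then have "B \<subseteq> {..<N}"
      using B by (auto simp: less_Suc_eq)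
    moreover have "{k \<in> B. ?X k ! i} = {k \<in> B. X k ! i}" for i
      using False by auto
    ultimately show ?thesis
      using ind B(2) by (auto simp: parity_independent_def)
  next
    case True
    define B' where "B' = B - {N}"
    have "B' \<subseteq> {..<N}"
      using B by (auto simp: less_Suc_eq B'_def)
    then have "x \<noteq> ?p B'"
      using xn by blast
    moreover have "length x = n"
      using x assms(1) by (auto simp: bitvecs_def)
    ultimately obtain i where i: "i < n" "x ! i \<noteq> odd (card {k \<in> B'. X k ! i})"
      by (auto simp: list_eq_iff_nth_eq)
    have fin: "finite B'"
      using \<open>B' \<subseteq> {..<N}\<close> finite_subset by blast
    have "{k \<in> B. ?X k ! i} =
        (if x ! i then insert N {k \<in> B'. X k ! i} else {k \<in> B'. X k ! i})"
      using True by (auto simp: B'_def)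
    moreover have "N \<notin> {k \<in> B'. X k ! i}"
      by (simp add: B'_def)
    ultimately have "odd (card {k \<in> B. ?X k ! i})"
      using i fin by (auto split: if_splits)
    then show ?thesis
      using i by blast
  qed
  then have "parity_independent n (Suc N) ?X"
    unfolding parity_independent_def by blast
  moreover have "\<forall>k<Suc N. ?X k \<in> \<X>"
    using X x by (auto simp: less_Suc_eq)
  ultimately show ?case
    by blast
qed

text \<open>This is distributivity, read as independence of the coordinates of a uniformly chosen
  list. It serves twice: for the bits of one vector \<open>s\<close> and for the entries of
  \<open>S\<close>.\<close>

lemma sum_lists_prod:
  fixes g :: "nat \<Rightarrow> 'b \<Rightarrow> 'a::comm_semiring_1"
  assumes "finite A"
  shows "(\<Sum>xs | set xs \<subseteq> A \<and> length xs = n. \<Prod>i<n. g i (xs ! i)) = (\<Prod>i<n. \<Sum>a\<in>A. g i a)"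
proof (induction n arbitrary: g)
  case 0
  have "{xs :: 'b list. set xs \<subseteq> A \<and> length xs = 0} = {[]}"
    by auto
  then show ?case by simp
next
  case (Suc n)
  let ?T = "\<lambda>n. {xs. set xs \<subseteq> A \<and> length xs = n}"
  have "bij_betw (\<lambda>(a, xs). a # xs) (A \<times> ?T n) (?T (Suc n))"
    by (auto simp: bij_betw_def inj_on_def image_iff length_Suc_conv)
  then have "(\<Sum>xs\<in>?T (Suc n). \<Prod>i<Suc n. g i (xs ! i)) =
      (\<Sum>z\<in>A \<times> ?T n. \<Prod>i<Suc n. g i ((case z of (a, xs) \<Rightarrow> a # xs) ! i))"
    by (rule sum.reindex_bij_betw[symmetric])
  also have "\<dots> = (\<Sum>(a, xs)\<in>A \<times> ?T n. g 0 a * (\<Prod>i<n. g (Suc i) (xs ! i)))"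
    by (rule sum.cong) (auto simp: prod.lessThan_Suc_shift simp del: prod.lessThan_Suc)
  also have "\<dots> = (\<Sum>a\<in>A. g 0 a) * (\<Sum>xs\<in>?T n. \<Prod>i<n. g (Suc i) (xs ! i))"
    by (simp add: sum_product sum.cartesian_product)
  also have "\<dots> = (\<Prod>i<Suc n. \<Sum>a\<in>A. g i a)"
    using Suc[of "\<lambda>i. g (Suc i)"] by (simp only: prod.lessThan_Suc_shift comp_def)
  finally show ?case .
qed

definition chi :: "bool list \<Rightarrow> bool list \<Rightarrow> real" where
  "chi s x = real_of_int (ip_sign s x)"

lemma chi_eq_prod:
  assumes "s \<in> bitvecs n"
  shows "chi s x = (\<Prod>i<n. if s ! i \<and> x ! i then -1 else 1)"
proof -
  have "ip_sign s x = (-1) ^ (\<Sum>i<length s. of_bool (s ! i) * of_bool (x ! i) :: nat)"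
    by (simp add: ip_sign_def minus_one_power_iff)
  also have "\<dots> = (\<Prod>i<n. (-1) ^ (of_bool (s ! i) * of_bool (x ! i)))"
    using assms unfolding bitvecs_def by (simp only: power_sum mem_Collect_eq)
  also have "\<dots> = (\<Prod>i<n. if s ! i \<and> x ! i then -1 else 1)"
    by (rule prod.cong) auto
  finally show ?thesis
    unfolding chi_def by (auto intro!: prod.cong)
qed

lemma chi_cases: "chi s x = 1 \<or> chi s x = -1"
  by (simp add: chi_def ip_sign_def minus_one_power_iff)

text \<open>The product is the character of the sum of the vectors in \<open>B\<close>, which is
  nonzero by independence. In a coordinate where that sum is 1, the two values of
  \<open>s ! i\<close> contribute 1 and -1, and this factor annihilates the total.\<close>

lemma sum_prod_chi:
  assumes X: "parity_independent n N X" and B: "B \<subseteq> {..<N}" "B \<noteq> {}"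
  shows "(\<Sum>s\<in>bitvecs n. \<Prod>k\<in>B. chi s (X k)) = 0"
proof -
  define g :: "nat \<Rightarrow> bool \<Rightarrow> real" where "g i b = (\<Prod>k\<in>B. if b \<and> X k ! i then -1 else 1)" for i b
  have fin: "finite B"
    using B finite_subset by blast
  have "(\<Sum>s\<in>bitvecs n. \<Prod>k\<in>B. chi s (X k)) = (\<Sum>s\<in>bitvecs n. \<Prod>i<n. g i (s ! i))"
  proof (rule sum.cong)
    fix s assume "s \<in> bitvecs n"
    then have "(\<Prod>k\<in>B. chi s (X k)) = (\<Prod>k\<in>B. \<Prod>i<n. if s ! i \<and> X k ! i then -1 else 1)"
      by (simp add: chi_eq_prod)
    also have "\<dots> = (\<Prod>i<n. g i (s ! i))"
      unfolding g_def by (rule prod.swap)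
    finally show "(\<Prod>k\<in>B. chi s (X k)) = (\<Prod>i<n. g i (s ! i))" .
  qed simp
  also have "\<dots> = (\<Prod>i<n. \<Sum>b\<in>UNIV. g i b)"
    using sum_lists_prod[of UNIV g n] by (simp add: bitvecs_def)
  also have "\<dots> = 0"
  proof -
    obtain i where i: "i < n" "odd (card {k \<in> B. X k ! i})"
      using X B by (auto simp: parity_independent_def)
    have "g i True = (\<Prod>k\<in>{k \<in> B. X k ! i}. -1)"
      unfolding g_def by (subst prod.inter_filter[OF fin]) simp
    also have "\<dots> = -1"
      using i by simp
    finally have "(\<Sum>b\<in>UNIV. g i b) = 0"
      by (simp add: UNIV_bool g_def)
    then show ?thesis
      using i by (auto simp: prod_zero_iff)
  qed
  finally show ?thesis .
qed

text \<open>A form of Hoeffding's estimate with a weaker exponent than \<open>x\<^sup>2 / 2\<close>.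
  The upper bound for \<open>exp (- y)\<close> is obtained by multiplying it with the quadratic
  Taylor bound for \<open>exp y\<close> and checking that the product is at least 1.\<close>

lemma cosh_le_exp_square:
  fixes x :: real
  assumes "\<bar>x\<bar> \<le> 1"
  shows "cosh x \<le> exp (x\<^sup>2)"
proof -
  have *: "cosh y \<le> exp (y\<^sup>2)" if y: "0 \<le> y" "y \<le> 1" for y :: real
  proof -
    have up: "exp y \<le> 1 + y + y\<^sup>2"
      using y by (rule exp_bound)
    have lo: "1 + y + y\<^sup>2 / 2 \<le> exp y"
      using y by (intro exp_lower_Taylor_quadratic)
    have pos: "1 - y + y\<^sup>2 \<ge> 0"
      using y by simp
    have "1 \<le> 1 + (y\<^sup>2 / 2 + y ^ 3 / 2 + y ^ 4 / 2)"
      using y by simp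
    also have "\<dots> = (1 + y + y\<^sup>2 / 2) * (1 - y + y\<^sup>2)"
      by (simp add: field_simps power2_eq_square power3_eq_cube power4_eq_xxxx)
    also have "\<dots> \<le> exp y * (1 - y + y\<^sup>2)"
      using lo pos by (rule mult_right_mono)
    finally have "exp (- y) \<le> 1 - y + y\<^sup>2"
      by (simp add: exp_minus field_simps)
    with up have "cosh y \<le> 1 + y\<^sup>2"
      by (simp add: cosh_field_def)
    also have "\<dots> \<le> exp (y\<^sup>2)"
      by simp
    finally show ?thesis .
  qed
  show ?thesis
    using *[of "\<bar>x\<bar>"] assms by simp
qed

text \<open>For uniform \<open>s\<close> the signs \<open>chi s (X k)\<close> have the moments of
  independent signs. As each is 1 or -1, its exponential is affine in it with coefficients sinh and
  cosh; after expansion over subsets \<open>B\<close>, only the empty set survives the summation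
  over \<open>s\<close>.\<close>

lemma chi_mgf:
  assumes X: "parity_independent n N X" and c: "\<And>k. k < N \<Longrightarrow> \<bar>c k\<bar> \<le> 1"
    and l: "0 \<le> l" "l \<le> 1"
  shows "(\<Sum>s\<in>bitvecs n. exp (l * (\<Sum>k<N. c k * chi s (X k)))) \<le> 2 ^ n * exp (l\<^sup>2 * real N)"
proof -
  let ?C = "\<lambda>k. cosh (l * c k)" and ?S = "\<lambda>k. sinh (l * c k)"
  have e: "exp (l * (\<Sum>k<N. c k * chi s (X k))) =
      (\<Sum>B\<in>Pow {..<N}. (\<Prod>k\<in>B. ?S k) * (\<Prod>k\<in>{..<N} - B. ?C k) * (\<Prod>k\<in>B. chi s (X k)))" for s
  proof -
    have "exp (l * (\<Sum>k<N. c k * chi s (X k))) = (\<Prod>k<N. exp (l * c k * chi s (X k)))"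
      by (simp add: sum_distrib_left exp_sum mult.assoc)
    also have "\<dots> = (\<Prod>k<N. ?S k * chi s (X k) + ?C k)"
    proof (rule prod.cong)
      fix k
      show "exp (l * c k * chi s (X k)) = ?S k * chi s (X k) + ?C k"
        using chi_cases[of s "X k"] by (auto simp: sinh_plus_cosh cosh_minus_sinh)
    qed simp
    also have "\<dots> = (\<Sum>B\<in>Pow {..<N}. (\<Prod>k\<in>B. ?S k * chi s (X k)) * (\<Prod>k\<in>{..<N} - B. ?C k))"
      by (rule prod_add) simp
    finally show ?thesis
      by (simp add: prod.distrib mult_ac)
  qed
  have "(\<Sum>s\<in>bitvecs n. exp (l * (\<Sum>k<N. c k * chi s (X k)))) =
      (\<Sum>B\<in>Pow {..<N}. (\<Prod>k\<in>B. ?S k) * (\<Prod>k\<in>{..<N} - B. ?C k) *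
        (\<Sum>s\<in>bitvecs n. \<Prod>k\<in>B. chi s (X k)))"
    unfolding e by (subst sum.swap) (simp add: sum_distrib_left)
  also have "\<dots> = (\<Sum>B\<in>{{}}. (\<Prod>k\<in>B. ?S k) * (\<Prod>k\<in>{..<N} - B. ?C k) *
        (\<Sum>s\<in>bitvecs n. \<Prod>k\<in>B. chi s (X k)))"
    by (rule sum.mono_neutral_right) (use sum_prod_chi[OF X] in auto)
  also have "\<dots> = 2 ^ n * (\<Prod>k<N. ?C k)"
    by (simp add: card_bitvecs)
  also have "(\<Prod>k<N. ?C k) \<le> (\<Prod>k<N. exp (l\<^sup>2))"
  proof (rule prod_mono, safe)
    fix k assume "k < N"
    then have "l * \<bar>c k\<bar> \<le> l * 1"
      using c l by (intro mult_left_mono) auto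
    then have a: "\<bar>l * c k\<bar> \<le> l"
      using l by (simp add: abs_mult)
    then have "?C k \<le> exp ((l * c k)\<^sup>2)"
      using l by (intro cosh_le_exp_square) linarith
    also have "(l * c k)\<^sup>2 \<le> l\<^sup>2"
      using a l by (metis abs_ge_zero power2_abs power_mono)
    finally show "?C k \<le> exp (l\<^sup>2)"
      by simp
  qed simp
  also have "(\<Prod>k<N. exp (l\<^sup>2)) = exp (l\<^sup>2 * real N)"
    by (simp add: exp_of_nat_mult mult.commute)
  finally show ?thesis
    by simp
qed

section \<open>Union bound over the vectors S\<close>

text \<open>Chernoff's bound for fixed \<open>X\<close>, \<open>V\<close> and \<alpha>, then a union
  bound whose three counting factors stand in \<open>small\<close>. All three are quantified after
  \<open>S\<close>, so they may depend on it, as they must for a data structure that preprocesses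
  \<open>S\<close>.\<close>

lemma exists_uncorrelated_list:
  fixes \<beta> :: "'v \<Rightarrow> 'z \<Rightarrow> real"
  assumes \<beta>: "\<And>V z. \<bar>\<beta> V z\<bar> \<le> 1"
    and \<V>: "finite \<V>"
    and Z: "\<And>q. q < m \<Longrightarrow> finite (Z q) \<and> card (Z q) \<le> z"
    and \<eta>: "0 \<le> \<eta>" "\<eta> \<le> 1"
    and small: "2 ^ (n * N) * real (card \<V>) ^ N * real z ^ m * exp (- (real m * real N * \<eta>\<^sup>2 / 4)) < 1"
  shows "\<exists>S. length S = m \<and> set S \<subseteq> bitvecs n \<and>
    (\<forall>X V \<alpha>. (\<forall>k<N. X k \<in> bitvecs n \<and> V k \<in> \<V>) \<longrightarrow> parity_independent n N X \<longrightarrow>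
      (\<forall>q<m. \<alpha> q \<in> Z q) \<longrightarrow>
      (\<Sum>q<m. \<Sum>k<N. \<beta> (V k) (\<alpha> q) * chi (S ! q) (X k)) < real m * real N * \<eta>)"
proof -
  define \<S> where "\<S> = {S. set S \<subseteq> bitvecs n \<and> length S = m}"
  have fin\<S>: "finite \<S>" and card\<S>: "card \<S> = (2 ^ n) ^ m"
    unfolding \<S>_def
    by (simp_all add: finite_lists_length_eq card_lists_length_eq finite_bitvecs card_bitvecs)
  define W where "W X V \<alpha> S = (\<Sum>q<m. \<Sum>k<N. \<beta> (V k) (\<alpha> q) * chi (S ! q) (X k))"
    for X :: "nat \<Rightarrow> bool list" and V :: "nat \<Rightarrow> 'v" and \<alpha> :: "nat \<Rightarrow> 'z" and S
  define bad where "bad X V \<alpha> = {S \<in> \<S>. real m * real N * \<eta> \<le> W X V \<alpha> S}" for X V \<alpha>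
  define \<delta> where "\<delta> = exp (- (real m * real N * \<eta>\<^sup>2 / 4))"
  have card_bad: "card (bad X V \<alpha>) \<le> card \<S> * \<delta>" if X: "parity_independent n N X" for X V \<alpha>
  proof -
    \<comment> \<open>This minimises \<open>l\<^sup>2 - l * \<eta>\<close>, which becomes
      \<open>- \<eta>\<^sup>2 / 4\<close>.\<close>
    define l where "l = \<eta> / 2"
    have l: "0 \<le> l" "l \<le> 1"
      using \<eta> by (simp_all add: l_def)
    let ?g = "\<lambda>q s. exp (l * (\<Sum>k<N. \<beta> (V k) (\<alpha> q) * chi s (X k)))"
    have "real (card (bad X V \<alpha>)) * exp (l * (real m * real N * \<eta>)) =
        (\<Sum>S\<in>bad X V \<alpha>. exp (l * (real m * real N * \<eta>)))"
      by simp
    also have "\<dots> \<le> (\<Sum>S\<in>bad X V \<alpha>. exp (l * W X V \<alpha> S))"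
      using l by (intro sum_mono) (auto simp: bad_def intro!: mult_left_mono)
    also have "\<dots> \<le> (\<Sum>S\<in>\<S>. exp (l * W X V \<alpha> S))"
      using fin\<S> by (intro sum_mono2) (auto simp: bad_def)
    also have "\<dots> = (\<Sum>S\<in>\<S>. \<Prod>q<m. ?g q (S ! q))"
      by (simp add: W_def sum_distrib_left[of l _ "{..<m}"] exp_sum)
    also have "\<dots> = (\<Prod>q<m. \<Sum>s\<in>bitvecs n. ?g q s)"
      unfolding \<S>_def by (rule sum_lists_prod) (rule finite_bitvecs)
    also have "\<dots> \<le> (\<Prod>q<m. 2 ^ n * exp (l\<^sup>2 * real N))"
      by (intro prod_mono conjI sum_nonneg chi_mgf X \<beta> l) auto
    also have "\<dots> = card \<S> * exp (real m * (l\<^sup>2 * real N))"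
      by (simp add: card\<S> power_mult_distrib exp_of_nat_mult)
    finally have "real (card (bad X V \<alpha>)) \<le>
        card \<S> * (exp (real m * (l\<^sup>2 * real N)) / exp (l * (real m * real N * \<eta>)))"
      by (simp add: pos_le_divide_eq)
    also have "exp (real m * (l\<^sup>2 * real N)) / exp (l * (real m * real N * \<eta>)) = \<delta>"
      unfolding exp_diff[symmetric] \<delta>_def l_def
      by (simp add: field_simps power2_eq_square)
    finally show ?thesis .
  qed
  define I where "I = {X \<in> {..<N} \<rightarrow>\<^sub>E bitvecs n. parity_independent n N X} \<times>
    ({..<N} \<rightarrow>\<^sub>E \<V>) \<times> (PiE {..<m} Z)"
  have finI: "finite I"
    unfolding I_def using \<V> Z
    by (intro finite_cartesian_product finite_PiE finite_subset[OF Collect_restrict])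
      (auto simp: finite_bitvecs)
  have "card {X \<in> {..<N} \<rightarrow>\<^sub>E bitvecs n. parity_independent n N X} \<le> card ({..<N} \<rightarrow>\<^sub>E bitvecs n)"
    by (intro card_mono finite_PiE) (auto simp: finite_bitvecs)
  also have "\<dots> = 2 ^ (n * N)"
    by (simp add: card_PiE card_bitvecs power_mult)
  finally have 1: "card {X \<in> {..<N} \<rightarrow>\<^sub>E bitvecs n. parity_independent n N X} \<le> 2 ^ (n * N)" .
  have "card (PiE {..<m} Z) = (\<Prod>q<m. card (Z q))"
    by (simp add: card_PiE)
  also have "\<dots> \<le> (\<Prod>q<m. z)"
    using Z by (intro prod_mono) auto
  finally have 2: "card (PiE {..<m} Z) \<le> z ^ m"
    by simp
  have "card I \<le> 2 ^ (n * N) * (card \<V> ^ N * z ^ m)"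
    unfolding I_def card_cartesian_product
    using 1 2 by (intro mult_mono) (auto simp: card_PiE)
  then have "real (card I) \<le> real (2 ^ (n * N) * (card \<V> ^ N * z ^ m))"
    using of_nat_le_iff by blast
  then have cardI: "real (card I) \<le> 2 ^ (n * N) * real (card \<V>) ^ N * real z ^ m"
    by (simp add: mult.assoc)
  define Bad where "Bad = (\<Union>(X, V, \<alpha>)\<in>I. bad X V \<alpha>)"
  have "real (card Bad) \<le> real (\<Sum>(X, V, \<alpha>)\<in>I. card (bad X V \<alpha>))"
    using card_UN_le[OF finI, of "\<lambda>(X, V, \<alpha>). bad X V \<alpha>"]
    unfolding Bad_def of_nat_le_iff by (simp add: case_prod_unfold)
  also have "\<dots> \<le> (\<Sum>i\<in>I. card \<S> * \<delta>)"
  proof (unfold of_nat_sum, rule sum_mono)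
    fix i assume "i \<in> I"
    then show "real (case i of (X, V, \<alpha>) \<Rightarrow> card (bad X V \<alpha>)) \<le> card \<S> * \<delta>"
      using card_bad by (cases i) (auto simp: I_def)
  qed
  also have "\<dots> = card I * \<delta> * card \<S>"
    by simp
  also have "\<dots> \<le> (2 ^ (n * N) * real (card \<V>) ^ N * real z ^ m) * \<delta> * card \<S>"
    using cardI by (intro mult_right_mono) (auto simp: \<delta>_def)
  also have "\<dots> < real (card \<S>)"
    using mult_strict_right_mono[OF small, of "real (card \<S>)"] card\<S> by (simp add: \<delta>_def)
  finally have "card Bad < card \<S>"
    by simp
  moreover have "Bad \<subseteq> \<S>"
    by (auto simp: Bad_def bad_def)
  ultimately obtain S where S: "S \<in> \<S>" "S \<notin> Bad"
    by (metis less_irrefl subsetI subset_antisym)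
  have "W X V \<alpha> S < real m * real N * \<eta>"
    if *: "\<forall>k<N. X k \<in> bitvecs n \<and> V k \<in> \<V>" "parity_independent n N X" "\<forall>q<m. \<alpha> q \<in> Z q"
    for X V \<alpha>
  proof -
    \<comment> \<open>The finite index set \<open>I\<close> contains only extensional functions;
      restriction changes none of the values that enter \<open>W\<close>.\<close>
    let ?X = "restrict X {..<N}" and ?V = "restrict V {..<N}" and ?\<alpha> = "restrict \<alpha> {..<m}"
    have "parity_independent n N ?X"
      unfolding parity_independent_def
    proof (intro allI impI)
      fix B assume B: "B \<subseteq> {..<N}" "B \<noteq> {}"
      then have "{k \<in> B. ?X k ! i} = {k \<in> B. X k ! i}" for i
        by auto
      with B *(2) show "\<exists>i<n. odd (card {k \<in> B. ?X k ! i})"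
        by (simp add: parity_independent_def)
    qed
    then have "(?X, ?V, ?\<alpha>) \<in> I"
      using * by (auto simp: I_def PiE_def)
    then have "W ?X ?V ?\<alpha> S < real m * real N * \<eta>"
      using S by (force simp: Bad_def bad_def)
    then show ?thesis
      by (simp add: W_def)
  qed
  then show ?thesis
    using S(1) unfolding W_def \<S>_def by blast
qed

section \<open>Cells covering many queries\<close>

text \<open>Every query names the colour of one of its cells, and some colour is named by a fraction
  \<open>1 / L\<close> of them. Publishing that whole class costs at most \<open>s\<close> cells and
  lowers the number of uncovered cells of each of these queries by at least one while any remain, so
  \<open>h\<close> rounds suffice.\<close>

lemma popular_union_coloured:
  fixes Z :: "'q \<Rightarrow> 'a set" and col :: "'a \<Rightarrow> nat"
  assumes "finite Q" and "finite T" and "0 < L"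
    and "\<And>a. a \<in> T \<Longrightarrow> col a < L"
    and "\<And>c. card {a \<in> T. col a = c} \<le> s"
    and "\<And>q. q \<in> Q \<Longrightarrow> Z q \<subseteq> T \<and> card (Z q) \<le> h"
  shows "\<exists>A\<subseteq>T. card A \<le> h * s \<and> card Q \<le> L ^ h * card {q \<in> Q. Z q \<subseteq> A}"
  using assms(1,6)
proof (induction h arbitrary: Q Z)
  case 0
  then have "Z q = {}" if "q \<in> Q" for q
    using that assms(2) by (metis card_0_eq finite_subset le_zero_eq)
  then have "{q \<in> Q. Z q \<subseteq> {}} = Q"
    by auto
  then show ?case
    by (intro exI[of _ "{}"]) simp
next
  case (Suc h)
  \<comment> \<open>Queries with nothing left to cover need some colour too; 0 is legitimate because
    \<open>0 < L\<close>.\<close>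
  define colour where "colour q = (if Z q = {} then 0 else col (SOME a. a \<in> Z q))" for q
  have some: "(SOME a. a \<in> Z q) \<in> Z q" if "Z q \<noteq> {}" for q
    using that by (simp add: some_in_eq)
  have col: "colour ` Q \<subseteq> {..<L}"
    using assms(3,4) Suc.prems(2) some by (fastforce simp: colour_def)
  have "\<exists>c<L. card Q \<le> L * card {q \<in> Q. colour q = c}"
  proof (rule ccontr)
    assume "\<not> ?thesis"
    then have *: "L * card {q \<in> Q. colour q = c} < card Q" if "c < L" for c
      using that by (meson not_le)
    have "L * card Q = L * (\<Sum>c<L. card {q \<in> Q. colour q = c})"
      using sum.group[OF Suc.prems(1) finite_lessThan col, of "\<lambda>_. 1::nat"] by simp
    also have "\<dots> = (\<Sum>c<L. L * card {q \<in> Q. colour q = c})"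
      by (rule sum_distrib_left)
    also have "\<dots> < (\<Sum>c<L. card Q)"
      using assms(3) * by (intro sum_strict_mono) auto
    finally show False
      by simp
  qed
  then obtain c where c: "card Q \<le> L * card {q \<in> Q. colour q = c}"
    by blast
  define Q' where "Q' = {q \<in> Q. colour q = c}"
  define C where "C = {a \<in> T. col a = c}"
  have "\<exists>A\<subseteq>T. card A \<le> h * s \<and> card Q' \<le> L ^ h * card {q \<in> Q'. Z q - C \<subseteq> A}"
  proof (rule Suc.IH)
    show "finite Q'"
      using Suc.prems(1) by (simp add: Q'_def)
    fix q assume q: "q \<in> Q'"
    then have Zq: "Z q \<subseteq> T" "card (Z q) \<le> Suc h"
      using Suc.prems(2) by (auto simp: Q'_def)
    have fin: "finite (Z q)"
      using Zq(1) assms(2) finite_subset by blast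
    have "card (Z q - C) \<le> h"
    proof (cases "Z q = {}")
      case False
      then have "(SOME a. a \<in> Z q) \<in> Z q \<inter> C"
        using q some Zq by (auto simp: Q'_def C_def colour_def)
      then have "card (Z q - C) < card (Z q)"
        using fin by (intro psubset_card_mono) auto
      then show ?thesis
        using Zq by simp
    qed simp
    then show "Z q - C \<subseteq> T \<and> card (Z q - C) \<le> h"
      using Zq by blast
  qed
  then obtain A where A: "A \<subseteq> T" "card A \<le> h * s"
      "card Q' \<le> L ^ h * card {q \<in> Q'. Z q - C \<subseteq> A}"
    by blast
  have "card {q \<in> Q'. Z q - C \<subseteq> A} \<le> card {q \<in> Q. Z q \<subseteq> A \<union> C}"
    using Suc.prems(1) by (intro card_mono) (auto simp: Q'_def)
  then have "L * card Q' \<le> L * (L ^ h * card {q \<in> Q. Z q \<subseteq> A \<union> C})"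
    using A(3) by (meson le_trans mult_le_mono2)
  then have "card Q \<le> L ^ Suc h * card {q \<in> Q. Z q \<subseteq> A \<union> C}"
    using c unfolding Q'_def by (simp only: power_Suc mult.assoc)
  moreover have "card (A \<union> C) \<le> Suc h * s"
    using card_Un_le[of A C] A(2) assms(5)[of c] by (simp add: C_def)
  moreover have "A \<union> C \<subseteq> T"
    using A by (auto simp: C_def)
  ultimately show ?case
    by blast
qed

text \<open>Enumerate \<open>T\<close> and colour by residues modulo \<open>L\<close>: within a
  class the quotients are distinct and below \<open>s\<close>.\<close>

lemma popular_union:
  fixes Z :: "'q \<Rightarrow> 'a set"
  assumes "finite Q" and T: "finite T" "card T \<le> L * s" and L: "0 < L"
    and "\<And>q. q \<in> Q \<Longrightarrow> Z q \<subseteq> T \<and> card (Z q) \<le> h"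
  shows "\<exists>A\<subseteq>T. card A \<le> h * s \<and> card Q \<le> L ^ h * card {q \<in> Q. Z q \<subseteq> A}"
proof -
  obtain f where f: "bij_betw f T {0..<card T}"
    using ex_bij_betw_finite_nat T(1) by blast
  have cls: "card {a \<in> T. f a mod L = c} \<le> s" for c
  proof -
    have "inj_on (\<lambda>a. f a div L) {a \<in> T. f a mod L = c}"
    proof (rule inj_onI)
      fix a b assume ab: "a \<in> {a \<in> T. f a mod L = c}" "b \<in> {a \<in> T. f a mod L = c}"
        and "f a div L = f b div L"
      then have "f a div L * L + f a mod L = f b div L * L + f b mod L"
        by simp
      then have "f a = f b"
        by (simp only: div_mult_mod_eq)
      then show "a = b"
        using f ab by (auto simp: bij_betw_def dest: inj_onD)
    qed
    moreover have "(\<lambda>a. f a div L) ` {a \<in> T. f a mod L = c} \<subseteq> {..<s}"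
    proof safe
      fix a assume "a \<in> T"
      then have "f a < card T"
        using f bij_betwE by fastforce
      also have "\<dots> \<le> s * L"
        using T(2) by (simp add: mult.commute)
      finally have "f a < s * L" .
      then show "f a div L < s"
        by (rule less_mult_imp_div_less)
    qed
    ultimately have "card {a \<in> T. f a mod L = c} \<le> card {..<s}"
      by (intro card_inj_on_le) auto
    then show ?thesis
      by simp
  qed
  show ?thesis
    by (rule popular_union_coloured[where col = "\<lambda>a. f a mod L"]) (use assms cls in auto)
qed

text \<open>List the elements of the subset and pad with \<open>None\<close> to length
  \<open>s\<close>; the extra symbol accounts for the \<open>+ 1\<close>.\<close>

lemma card_small_subsets:
  assumes "finite U"
  shows "finite {B. B \<subseteq> U \<and> card B \<le> s} \<and> card {B. B \<subseteq> U \<and> card B \<le> s} \<le> (card U + 1) ^ s"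
proof -
  let ?L = "{xs :: 'a option list. set xs \<subseteq> insert None (Some ` U) \<and> length xs = s}"
  have fin: "finite ?L"
    using assms by (intro finite_lists_length_eq) simp
  have sub: "{B. B \<subseteq> U \<and> card B \<le> s} \<subseteq> (\<lambda>xs. {a. Some a \<in> set xs}) ` ?L"
  proof safe
    fix B assume B: "B \<subseteq> U" "card B \<le> s"
    have "finite B"
      using B assms finite_subset by blast
    then obtain ys where ys: "set ys = B" "distinct ys"
      using finite_distinct_list by blast
    have len: "length ys \<le> s"
      using ys B distinct_card by metis
    let ?xs = "map Some ys @ replicate (s - length ys) None"
    have "?xs \<in> ?L"
      using B ys len by auto
    moreover have "B = {a. Some a \<in> set ?xs}"
      using ys by auto
    ultimately show "B \<in> (\<lambda>xs. {a. Some a \<in> set xs}) ` ?L"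
      by blast
  qed
  have "card ((\<lambda>xs. {a. Some a \<in> set xs}) ` ?L) \<le> card ?L"
    by (rule card_image_le[OF fin])
  also have "\<dots> = card (insert None (Some ` U)) ^ s"
    using assms by (intro card_lists_length_eq) simp
  also have "card (insert None (Some ` U)) = card U + 1"
    using assms by (auto simp: card_insert_if card_image)
  finally show ?thesis
    using sub fin by (meson card_mono finite_imageI finite_subset le_trans)
qed

section \<open>Epochs\<close>

definition written_between :: "multiphase_ds \<Rightarrow> bool list list \<Rightarrow> bool list \<Rightarrow> nat \<Rightarrow> nat \<Rightarrow> nat set" where
  "written_between D S X a b = (\<Union>j\<in>{a..<b}. written (update D j (X ! j)) (memory_after D S X j))"

lemma finite_written_between: "finite (written_between D S X a b)"
  by (simp add: written_between_def finite_written)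

lemma card_written_between:
  assumes "\<And>j. j < b \<Longrightarrow> probes (update D j (X ! j)) (memory_after D S X j) \<le> u"
  shows "card (written_between D S X a b) \<le> (b - a) * u"
proof -
  have "card (written_between D S X a b) \<le>
      (\<Sum>j\<in>{a..<b}. card (written (update D j (X ! j)) (memory_after D S X j)))"
    unfolding written_between_def by (rule card_UN_le) simp
  also have "\<dots> \<le> (\<Sum>j\<in>{a..<b}. u)"
  proof (rule sum_mono)
    fix j assume "j \<in> {a..<b}"
    then show "card (written (update D j (X ! j)) (memory_after D S X j)) \<le> u"
      using assms[of j] card_written[of "update D j (X ! j)" "memory_after D S X j"] by simp
  qed
  finally show ?thesis
    by simp
qed

lemma written_between_mono: "a \<le> a' \<Longrightarrow> b' \<le> b \<Longrightarrow> written_between D S X a' b' \<subseteq> written_between D S X a b"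
  unfolding written_between_def by (rule UN_mono) auto

lemma written_between_split:
  "a \<le> b \<Longrightarrow> b \<le> c \<Longrightarrow> written_between D S X a c = written_between D S X a b \<union> written_between D S X b c"
  unfolding written_between_def by (simp add: ivl_disj_un_two(3)[of a b c, symmetric] UN_Un)

lemma memory_after_unwritten:
  "a \<le> b \<Longrightarrow> x \<notin> written_between D S X a b \<Longrightarrow> memory_after D S X b x = memory_after D S X a x"
proof (induction b rule: dec_induct)
  case (step b)
  have "memory_after D S X (Suc b) x = memory_after D S X b x"
    using step.hyps step.prems by (simp add: written_between_def final_memory_unwritten)
  moreover have "x \<notin> written_between D S X a b"
    using step.prems written_between_mono[of a a b "Suc b"] by auto
  ultimately show ?case
    using step.IH by simp
qed simp

lemma memory_after_prefix:
  assumes "take a X = take a X'"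
  shows "memory_after D S X a = memory_after D S X' a"
proof -
  have nth: "X ! j = X' ! j" if "j < a" for j
    using assms that by (metis nth_take)
  have "j \<le> a \<Longrightarrow> memory_after D S X j = memory_after D S X' j" for j
    by (induction j) (simp_all add: nth)
  then show ?thesis
    by simp
qed

lemma word_memory_after: "word_ds w D \<Longrightarrow> word_memory w (memory_after D S X j)"
  by (induction j) (simp_all add: word_ds_def word_memory_final)

section \<open>The contradiction for fixed parameters\<close>

lemma two_power_le_exp: "(2::real) ^ k \<le> exp (real k)"
proof -
  have "(2::real) \<le> exp 1"
    using exp_ge_add_one_self[of 1] by simp
  then have "(2::real) ^ k \<le> exp 1 ^ k"
    by (intro power_mono) auto
  then show ?thesis
    by (simp add: exp_of_nat_mult[symmetric])
qed

text \<open>The parameters stay free so that only counting remains. There are \<open>K\<close>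
  epochs with boundaries \<open>g * B ^ k\<close> updates before the end; \<open>h\<close> bounds
  the charged probes of a typical query, \<open>L\<close> is the number of colours, \<open>r\<close>
  bounds the bits for an address with its word, and \<eta> is the correlation forced on average by
  covering a fraction \<open>1 / (2 * L ^ h)\<close> of the queries.\<close>

lemma no_multiphase_ds:
  fixes n m w u t N L K h g B r :: nat and \<eta> :: real
  assumes D: "solves_multiphase ip_sign n m w u t D"
    and pos: "0 < K" "0 < L" "0 < B" "0 < m"
    and gB: "g * B ^ K \<le> n"
    and t: "2 * t \<le> K * Suc h"
    and g: "4 * (N + K + r * h) \<le> g"
    and L: "4 * r * h * u \<le> L"
    and B: "4 * r * u \<le> B"
    and \<eta>: "0 \<le> \<eta>" "2 * \<eta> * real L ^ h \<le> 1"
    and small: "real (n * N * (1 + r * u) + r * m) < real m * real N * \<eta>\<^sup>2 / 4"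
    and r: "m * 2 ^ (w * t) * t * 2 ^ w + 1 \<le> 2 ^ r" "2 ^ (w * t) + 1 \<le> (2::nat) ^ r"
  shows False
proof -
  have wds: "word_ds w D"
    using D by (simp add: solves_multiphase_def)
  \<comment> \<open>The cells that some query can reach within \<open>t\<close> probes from some
    word memory. Messages and the sets \<open>V\<close> are cut down to \<open>R\<close>, which
    makes their number finite and small.\<close>
  define R where "R = (\<Union>q<m. \<Union>(P, _)\<in>outcomes w t (query D q). P)"
  have out: "finite (outcomes w t (query D q))" "card (outcomes w t (query D q)) \<le> 2 ^ (w * t)" for q
    using card_outcomes[of w "query D q" t] wds by (auto simp: word_ds_def)
  have outP: "finite P \<and> card P \<le> t" if "(P, x) \<in> outcomes w t (query D q)" for P x q
  proof -
    from that obtain M where "P = probed (query D q) M" "probes (query D q) M \<le> t"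
      by (auto simp: outcomes_def)
    then show ?thesis
      using card_probed[of "query D q" M] by (simp add: finite_probed)
  qed
  have finR: "finite R"
    unfolding R_def using out outP by auto
  have cardR: "card R \<le> m * 2 ^ (w * t) * t"
  proof -
    have "card (\<Union>(P, _)\<in>outcomes w t (query D q). P) \<le> 2 ^ (w * t) * t" for q
    proof -
      have "card (\<Union>(P, _)\<in>outcomes w t (query D q). P) \<le> (\<Sum>(P, _)\<in>outcomes w t (query D q). card P)"
        using card_UN_le[OF out(1)[of q], of fst] by (simp add: case_prod_unfold)
      also have "\<dots> \<le> (\<Sum>_\<in>outcomes w t (query D q). t)"
        using outP by (intro sum_mono) auto
      also have "\<dots> \<le> 2 ^ (w * t) * t"
        using out(2) by simp
      finally show ?thesis .
    qed
    then have "(\<Sum>q<m. card (\<Union>(P, _)\<in>outcomes w t (query D q). P)) \<le> (\<Sum>q<m. 2 ^ (w * t) * t)"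
      by (rule sum_mono)
    moreover have "card R \<le> (\<Sum>q<m. card (\<Union>(P, _)\<in>outcomes w t (query D q). P))"
      unfolding R_def by (rule card_UN_le) simp
    ultimately show ?thesis
      by (simp add: mult.assoc)
  qed
  have R1: "card R * 2 ^ w + 1 \<le> 2 ^ r"
  proof -
    have "card R * 2 ^ w \<le> m * 2 ^ (w * t) * t * 2 ^ w"
      using cardR by (rule mult_le_mono1)
    then show ?thesis
      using r(1) by linarith
  qed
  have R2: "card R + 1 \<le> 2 ^ r"
  proof -
    have "card R * 1 \<le> card R * 2 ^ w"
      by (rule mult_le_mono2) simp
    then show ?thesis
      using R1 by linarith
  qed
  \<comment> \<open>The extra outcome \<open>({}, 0)\<close> stands for runs that exceed \<open>t\<close> probes; \<open>\<beta>\<close> maps it to \<open>0\<close>.\<close>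
  define Z where "Z q = insert ({}, 0) (outcomes w t (query D q))" for q
  define \<V> where "\<V> = {V. V \<subseteq> R \<and> card V \<le> n * u}"
  \<comment> \<open>A run on a wrong memory may return any integer; the test
    \<open>\<bar>x\<bar> = 1\<close> keeps the table bounded by 1.\<close>
  define \<beta> :: "nat set \<Rightarrow> nat set \<times> int \<Rightarrow> real" where
    "\<beta> V = (\<lambda>(P, x). if P \<inter> V = {} \<and> \<bar>x\<bar> = 1 then real_of_int x else 0)" for V
  have "\<exists>S. length S = m \<and> set S \<subseteq> bitvecs n \<and>
    (\<forall>X V \<alpha>. (\<forall>k<N. X k \<in> bitvecs n \<and> V k \<in> \<V>) \<longrightarrow> parity_independent n N X \<longrightarrow>
      (\<forall>q<m. \<alpha> q \<in> Z q) \<longrightarrow>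
      (\<Sum>q<m. \<Sum>k<N. \<beta> (V k) (\<alpha> q) * chi (S ! q) (X k)) < real m * real N * \<eta>)"
  proof (rule exists_uncorrelated_list[where z = "2 ^ r"])
    show "\<bar>\<beta> V z\<bar> \<le> 1" for V z
      by (auto simp: \<beta>_def split: prod.splits)
    show "finite \<V>"
      unfolding \<V>_def using card_small_subsets[OF finR] by blast
    show "finite (Z q) \<and> card (Z q) \<le> 2 ^ r" for q
    proof -
      have "card (Z q) \<le> card (outcomes w t (query D q)) + 1"
        unfolding Z_def using out(1) by (simp add: card_insert_if)
      also have "\<dots> \<le> 2 ^ (w * t) + 1"
        using out(2) by simp
      finally show ?thesis
        using out(1) r(2) unfolding Z_def by (meson finite_insert le_trans)
    qed
    show "0 \<le> \<eta>" by fact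
    have "1 \<le> real L ^ h"
      using pos by (simp add: one_le_power)
    then have "\<eta> * 1 \<le> \<eta> * real L ^ h"
      using \<eta>(1) by (rule mult_left_mono)
    then show "\<eta> \<le> 1"
      using \<eta> by linarith
    have "card \<V> \<le> (card R + 1) ^ (n * u)"
      unfolding \<V>_def using card_small_subsets[OF finR] by blast
    also have "\<dots> \<le> (2 ^ r) ^ (n * u)"
      using R2 by (rule power_mono) simp
    finally have "real (card \<V>) \<le> real ((2 ^ r) ^ (n * u))"
      using of_nat_le_iff by blast
    then have "real (card \<V>) ^ N \<le> ((2 ^ r) ^ (n * u)) ^ N"
      by (intro power_mono) auto
    then have "2 ^ (n * N) * real (card \<V>) ^ N * real (2 ^ r) ^ m * exp (- (real m * real N * \<eta>\<^sup>2 / 4))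
      \<le> 2 ^ (n * N) * ((2 ^ r) ^ (n * u)) ^ N * real (2 ^ r) ^ m * exp (- (real m * real N * \<eta>\<^sup>2 / 4))"
      by (intro mult_right_mono mult_left_mono) auto
    also have "\<dots> = 2 ^ (n * N * (1 + r * u) + r * m) * exp (- (real m * real N * \<eta>\<^sup>2 / 4))"
    proof -
      have "n * N * (1 + r * u) + r * m = n * N + r * (n * u) * N + r * m"
        by (simp add: algebra_simps)
      then show ?thesis
        by (simp only: power_add power_mult of_nat_power of_nat_numeral)
    qed
    also have "\<dots> \<le> exp (real (n * N * (1 + r * u) + r * m)) * exp (- (real m * real N * \<eta>\<^sup>2 / 4))"
      by (intro mult_right_mono two_power_le_exp) simp
    also have "\<dots> < 1"
      using small by (simp only: exp_add[symmetric] exp_less_one_iff)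
    finally show "2 ^ (n * N) * real (card \<V>) ^ N * real (2 ^ r) ^ m *
      exp (- (real m * real N * \<eta>\<^sup>2 / 4)) < 1" .
  qed
  then obtain S where S: "length S = m" "set S \<subseteq> bitvecs n"
    and uncor: "\<And>X V \<alpha>. (\<forall>k<N. X k \<in> bitvecs n \<and> V k \<in> \<V>) \<Longrightarrow> parity_independent n N X \<Longrightarrow>
      (\<forall>q<m. \<alpha> q \<in> Z q) \<Longrightarrow>
      (\<Sum>q<m. \<Sum>k<N. \<beta> (V k) (\<alpha> q) * chi (S ! q) (X k)) < real m * real N * \<eta>"
    by blast

  \<comment> \<open>The last \<open>e 0 = g\<close> updates belong to no epoch and are later than
    all of them.\<close>
  define e where "e k = g * B ^ k" for k
  have e_Suc: "e (Suc k) = B * e k" for k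
    by (simp add: e_def)
  have e_mono: "e j \<le> e k" if "j \<le> k" for j k
    unfolding e_def using that pos by (intro mult_le_mono2 power_increasing) auto
  have e_le: "e k \<le> n" if "k \<le> K" for k
    using e_mono[OF that] gB unfolding e_def by (rule le_trans)
  define mem where "mem X = memory_after D S X n" for X
  \<comment> \<open>Epoch \<open>k\<close> consists of the updates \<open>n - e (Suc k), \<dots>, n - e k - 1\<close>, so larger \<open>k\<close> is earlier.\<close>
  define later where "later k X = written_between D S X (n - e k) n" for k X
  define hits where "hits k X = written_between D S X (n - e (Suc k)) (n - e k) - later k X" for k X
  define P where "P q X = probed (query D q) (mem X)" for q X

  have upd: "probes (update D j (X ! j)) (memory_after D S X j) \<le> u" if "X \<in> bitvecs n" "j < n" for X j
    using D S that by (auto simp: solves_multiphase_def)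
  have qry: "result (query D q) (mem X) = ip_sign (S ! q) X" "probes (query D q) (mem X) \<le> t"
    if "X \<in> bitvecs n" "q < m" for X q
    using D S that by (auto simp: solves_multiphase_def mem_def)
  have word_mem: "word_memory w (memory_after D S X j)" for X j
    using wds by (rule word_memory_after)
  have P_R: "P q X \<subseteq> R" if "X \<in> bitvecs n" "q < m" for q X
  proof -
    have "(P q X, result (query D q) (mem X)) \<in> outcomes w t (query D q)"
      unfolding P_def using qry that word_mem by (intro outcomesI) (auto simp: mem_def)
    then show ?thesis
      using that unfolding R_def by blast
  qed
  have cardP: "card (P q X) \<le> t" if "X \<in> bitvecs n" "q < m" for q X
    using card_probed[of "query D q" "mem X"] qry(2)[OF that] by (simp add: P_def)
  have card_later: "card (later k X) \<le> e k * u" if "X \<in> bitvecs n" "k \<le> K" for k X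
    using card_written_between[of n D X S u "n - e k"] upd that e_le[of k] by (simp add: later_def)
  have fin_hits: "finite (hits k X)" for k X
    by (simp add: hits_def finite_written_between)
  have card_hits: "card (hits k X) \<le> e (Suc k) * u" if "X \<in> bitvecs n" "k < K" for k X
  proof -
    have "card (hits k X) \<le> card (written_between D S X (n - e (Suc k)) (n - e k))"
      unfolding hits_def by (rule card_mono) (auto simp: finite_written_between)
    also have "\<dots> \<le> (n - e k - (n - e (Suc k))) * u"
      using upd that by (intro card_written_between) auto
    also have "\<dots> \<le> e (Suc k) * u"
      by (rule mult_le_mono1) simp
    finally show ?thesis .
  qed
  have hits_disjoint: "hits j X \<inter> hits k X = {}" if "j < k" for j k X
  proof -
    have "hits j X \<subseteq> later k X"
      unfolding hits_def later_def using e_mono[of "Suc j" k] that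
      by (intro order.trans[OF Diff_subset written_between_mono]) auto
    then show ?thesis
      by (auto simp: hits_def)
  qed

  \<comment> \<open>The sets \<open>hits k X\<close> are disjoint, so over all epochs a query is
    charged at most \<open>t\<close> probes; averaging over the \<open>K\<close> epochs yields one
    with at most \<open>m * t / K\<close> charges. It may depend on \<open>X\<close>.\<close>
  have ex_epoch: "\<exists>k<K. K * (\<Sum>q<m. card (P q X \<inter> hits k X)) \<le> m * t" if X: "X \<in> bitvecs n" for X
  proof (rule ccontr)
    assume "\<not> ?thesis"
    then have *: "m * t < K * (\<Sum>q<m. card (P q X \<inter> hits k X))" if "k < K" for k
      using that by (meson not_le)
    have "K * (m * t) = (\<Sum>k<K. m * t)"
      by simp
    also have "\<dots> < (\<Sum>k<K. K * (\<Sum>q<m. card (P q X \<inter> hits k X)))"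
      using * pos by (intro sum_strict_mono) auto
    also have "\<dots> = K * (\<Sum>q<m. \<Sum>k<K. card (P q X \<inter> hits k X))"
      by (subst sum.swap) (simp only: sum_distrib_left)
    also have "\<dots> \<le> K * (\<Sum>q<m. t)"
    proof (intro mult_le_mono2 sum_mono)
      fix q assume "q \<in> {..<m}"
      have "(\<Sum>k<K. card (P q X \<inter> hits k X)) = card (\<Union>k<K. P q X \<inter> hits k X)"
        using hits_disjoint fin_hits
        by (intro card_UN_disjoint[symmetric]) (auto, metis disjoint_iff linorder_neqE_nat)
      also have "\<dots> \<le> card (P q X)"
        by (rule card_mono) (auto simp: P_def finite_probed)
      also have "\<dots> \<le> t"
        using X \<open>q \<in> {..<m}\<close> cardP by simp
      finally show "(\<Sum>k<K. card (P q X \<inter> hits k X)) \<le> t" .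
    qed
    finally show False
      by simp
  qed

  \<comment> \<open>Rounding up ensures \<open>e (Suc k) * u \<le> L * s k\<close>. The additional 1
    is what the summand \<open>r * h\<close> in the bound on \<open>g\<close> pays for.\<close>
  define s where "s k = e (Suc k) * u div L + 1" for k
  define good where "good X k A \<longleftrightarrow> k < K \<and> A \<subseteq> hits k X \<and> card A \<le> h * s k \<and>
      m \<le> 2 * L ^ h * card {q. q < m \<and> P q X \<inter> hits k X \<subseteq> A}" for X k A
  have ex_good: "\<exists>k A. good X k A" if X: "X \<in> bitvecs n" for X
  proof -
    obtain k where k: "k < K" "K * (\<Sum>q<m. card (P q X \<inter> hits k X)) \<le> m * t"
      using ex_epoch[OF X] by blast
    define Q where "Q = {q. q < m \<and> card (P q X \<inter> hits k X) \<le> h}"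
    \<comment> \<open>Markov's inequality: a query outside \<open>Q\<close> has at least
      \<open>Suc h\<close> charged probes, and \<open>2 * t \<le> K * Suc h\<close> leaves room for
      at most half of the queries there.\<close>
    have "m \<le> 2 * card Q"
    proof -
      have "K * (Suc h * card ({..<m} - Q)) = K * (\<Sum>q\<in>{..<m} - Q. Suc h)"
        by simp
      also have "\<dots> \<le> K * (\<Sum>q\<in>{..<m} - Q. card (P q X \<inter> hits k X))"
        by (intro mult_le_mono2 sum_mono) (auto simp: Q_def)
      also have "\<dots> \<le> K * (\<Sum>q<m. card (P q X \<inter> hits k X))"
        by (intro mult_le_mono2 sum_mono2) auto
      also note k(2)
      finally have "K * Suc h * (2 * card ({..<m} - Q)) \<le> m * (2 * t)"
        by (simp add: algebra_simps)
      also have "\<dots> \<le> K * Suc h * m"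
        using t by (simp add: mult.commute)
      finally have "2 * card ({..<m} - Q) \<le> m"
        using pos by (simp del: mult_Suc_right)
      moreover have "card ({..<m} - Q) = m - card Q"
        by (subst card_Diff_subset) (auto simp: Q_def)
      ultimately show ?thesis
        by linarith
    qed
    have "card (hits k X) \<le> L * s k"
    proof -
      have "e (Suc k) * u \<le> L * s k"
        using dividend_less_times_div[OF pos(2), of "e (Suc k) * u"] by (simp add: s_def)
      then show ?thesis
        using card_hits[OF X k(1)] by linarith
    qed
    then have "\<exists>A\<subseteq>hits k X. card A \<le> h * s k \<and>
        card Q \<le> L ^ h * card {q \<in> Q. P q X \<inter> hits k X \<subseteq> A}"
      using pos fin_hits by (intro popular_union) (auto simp: Q_def)
    then obtain A where A: "A \<subseteq> hits k X" "card A \<le> h * s k"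
        "card Q \<le> L ^ h * card {q \<in> Q. P q X \<inter> hits k X \<subseteq> A}"
      by blast
    have "card {q \<in> Q. P q X \<inter> hits k X \<subseteq> A} \<le> card {q. q < m \<and> P q X \<inter> hits k X \<subseteq> A}"
      by (rule card_mono) (auto simp: Q_def)
    then have "2 * card Q \<le> 2 * (L ^ h * card {q. q < m \<and> P q X \<inter> hits k X \<subseteq> A})"
      using A(3) by (meson le_trans mult_le_mono2)
    then show ?thesis
      unfolding good_def using A(1,2) k(1) \<open>m \<le> 2 * card Q\<close>
      by (intro exI[of _ k] exI[of _ A]) (simp add: mult.assoc)
  qed
  then obtain kk AA where "\<And>X. X \<in> bitvecs n \<Longrightarrow> good X (kk X) (AA X)"
    by metis
  note kA = this[unfolded good_def]

  define sent where "sent X = (later (kk X) X \<union> AA X) \<inter> R" for X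
  \<comment> \<open>The pairs carry their addresses, so \<open>sent X\<close> is recoverable from
    the message by projection.\<close>
  define msg where "msg X = (\<lambda>a. (a, mem X a)) ` sent X" for X
  \<comment> \<open>Not only the bits of the epoch are omitted but also all later ones, so the
    message has a budget of the full \<open>e (Suc k)\<close> bits.\<close>
  define key where "key X = (kk X, take (n - e (Suc (kk X))) X, msg X)" for X
  define sz where "sz k = h * s k + e k * u" for k
  define \<M> where "\<M> k = {\<mu>. \<mu> \<subseteq> R \<times> bitvecs w \<and> card \<mu> \<le> sz k}" for k
  define keys where "keys = (SIGMA k:{..<K}. bitvecs (n - e (Suc k)) \<times> \<M> k)"
  have \<M>: "finite (\<M> k)" "card (\<M> k) \<le> 2 ^ (r * sz k)" for k
  proof -
    have *: "finite (R \<times> bitvecs w)"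
      using finR finite_bitvecs by blast
    show "finite (\<M> k)"
      unfolding \<M>_def using card_small_subsets[OF *] by blast
    have "card (\<M> k) \<le> (card (R \<times> bitvecs w) + 1) ^ sz k"
      unfolding \<M>_def using card_small_subsets[OF *] by blast
    also have "\<dots> \<le> (2 ^ r) ^ sz k"
      using R1 by (intro power_mono) (auto simp: card_cartesian_product card_bitvecs)
    finally show "card (\<M> k) \<le> 2 ^ (r * sz k)"
      by (simp add: power_mult)
  qed
  have key_in: "key ` bitvecs n \<subseteq> keys"
  proof (rule image_subsetI)
    fix X assume X: "X \<in> bitvecs n"
    note kX = kA[OF X]
    have "card (msg X) \<le> card (sent X)"
      unfolding msg_def using finR by (intro card_image_le) (simp add: sent_def)
    also have "\<dots> \<le> card (later (kk X) X \<union> AA X)"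
      using kX fin_hits finite_subset unfolding sent_def
      by (intro card_mono) (auto simp: later_def finite_written_between)
    also have "\<dots> \<le> card (later (kk X) X) + card (AA X)"
      by (rule card_Un_le)
    also have "\<dots> \<le> sz (kk X)"
      using kX card_later[OF X, of "kk X"] by (simp add: sz_def)
    finally have "msg X \<in> \<M> (kk X)"
      using word_mem[of X n] by (auto simp: \<M>_def msg_def sent_def word_memory_def mem_def)
    then show "key X \<in> keys"
      using X kX by (auto simp: key_def keys_def bitvecs_def)
  qed
  \<comment> \<open>The sampled cells, the later cells and the additive overhead each take at most a
    quarter of \<open>e (Suc k)\<close>.\<close>
  have sz: "r * sz k + N + K \<le> e (Suc k)" if "k < K" for k
  proof -
    define d where "d = e (Suc k) * u div L"
    have 1: "4 * (r * h * d) \<le> e (Suc k)"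
    proof (cases "u = 0")
      case False
      have "(4 * (r * h * d)) * u = d * (4 * r * h * u)"
        by simp
      also have "\<dots> \<le> d * L"
        using L by (rule mult_le_mono2)
      also have "\<dots> \<le> e (Suc k) * u"
        unfolding d_def by (rule div_times_less_eq_dividend)
      finally show ?thesis
        using False by simp
    qed (simp add: d_def)
    have 2: "4 * (r * u * e k) \<le> e (Suc k)"
      using mult_le_mono1[OF B, of "e k"] by (simp add: e_Suc mult.assoc)
    have "g \<le> e (Suc k)"
      using e_mono[of 0 "Suc k"] by (simp add: e_def del: power_Suc)
    then have 3: "4 * (N + K + r * h) \<le> e (Suc k)"
      using g by linarith
    have "r * sz k + N + K = r * h * d + r * u * e k + (N + K + r * h)"
      by (simp add: sz_def s_def d_def algebra_simps)
    also have "\<dots> \<le> e (Suc k)"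
    proof -
      have "x + y + z \<le> v" if "4 * x \<le> v" "4 * y \<le> v" "4 * z \<le> v" for x y z v :: nat
        using that by linarith
      then show ?thesis
        using 1 2 3 by blast
    qed
    finally show ?thesis .
  qed
  \<comment> \<open>Pigeonhole: the keys of one epoch, times \<open>2 ^ N\<close>, number at most
    \<open>2 ^ (n - K)\<close>, and \<open>K < 2 ^ K\<close> absorbs the choice of the epoch. Fibres
    of size at most \<open>2 ^ N\<close> could not exhaust all \<open>2 ^ n\<close> vectors.\<close>
  have "\<exists>y\<in>keys. 2 ^ N < card {X \<in> bitvecs n. key X = y}"
  proof (rule ccontr)
    assume "\<not> ?thesis"
    then have le: "card {X \<in> bitvecs n. key X = y} \<le> 2 ^ N" if "y \<in> keys" for y
      using that by (meson not_le)
    have fin: "finite keys"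
      unfolding keys_def using \<M> finite_bitvecs by blast
    have "2 ^ n = card (bitvecs n)"
      by (simp add: card_bitvecs)
    also have "\<dots> = (\<Sum>y\<in>keys. card {X \<in> bitvecs n. key X = y})"
      using sum.group[OF finite_bitvecs fin key_in, of "\<lambda>_. 1::nat"] by simp
    also have "\<dots> \<le> card keys * 2 ^ N"
      using sum_bounded_above[of keys, OF le] by simp
    also have "card keys = (\<Sum>k<K. card (bitvecs (n - e (Suc k)) \<times> \<M> k))"
      unfolding keys_def using \<M> finite_bitvecs by (intro card_SigmaI) auto
    also have "\<dots> * 2 ^ N = (\<Sum>k<K. card (bitvecs (n - e (Suc k)) \<times> \<M> k) * 2 ^ N)"
      by (rule sum_distrib_right)
    also have "\<dots> \<le> (\<Sum>k<K. 2 ^ (n - K))"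
    proof (rule sum_mono)
      fix k assume "k \<in> {..<K}"
      then have k: "k < K" by simp
      have "card (bitvecs (n - e (Suc k)) \<times> \<M> k) * 2 ^ N \<le> 2 ^ (n - e (Suc k)) * 2 ^ (r * sz k) * 2 ^ N"
        using \<M>(2) by (simp add: card_cartesian_product card_bitvecs)
      also have "\<dots> = 2 ^ (n - e (Suc k) + r * sz k + N)"
        by (simp add: power_add)
      also have "\<dots> \<le> 2 ^ (n - K)"
        using sz[OF k] e_le[of "Suc k"] k by (intro power_increasing) auto
      finally show "card (bitvecs (n - e (Suc k)) \<times> \<M> k) * 2 ^ N \<le> 2 ^ (n - K)" .
    qed
    also have "\<dots> = K * 2 ^ (n - K)"
      by simp
    also have "\<dots> < 2 ^ K * 2 ^ (n - K)"
      by (intro mult_strict_right_mono) auto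
    also have "\<dots> = 2 ^ n"
      using sz[of 0] e_le[of 1] pos by (simp add: power_add[symmetric])
    finally show False
      by simp
  qed
  then obtain y where y: "2 ^ N < card {X \<in> bitvecs n. key X = y}"
    by blast
  define \<X> where "\<X> = {X \<in> bitvecs n. key X = y}"
  obtain Xs where Xs: "\<And>k. k < N \<Longrightarrow> Xs k \<in> \<X>" and ind: "parity_independent n N Xs"
    using exists_parity_independent[of \<X> n N] y by (auto simp: \<X>_def)
  have "\<X> \<noteq> {}"
    using y unfolding \<X>_def by (metis card.empty not_less_zero)
  then obtain X0 where X0: "X0 \<in> \<X>"
    by blast
  define k where "k = kk X0"
  define a where "a = n - e (Suc k)"
  \<comment> \<open>\<open>X0\<close> is merely a representative: the published cells and the prefix
    of length \<open>a\<close> are determined by the key, hence one \<open>sim\<close>, and one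
    \<alpha>, serves every member of \<X>.\<close>
  define sim where "sim x = (if x \<in> sent X0 then mem X0 x else memory_after D S X0 a x)" for x
  define \<alpha> where "\<alpha> q = (if probes (query D q) sim \<le> t
      then (probed (query D q) sim, result (query D q) sim) else ({}, 0))" for q
  define V where "V X = (hits k X - AA X) \<inter> R" for X
  have word_sim: "word_memory w sim"
    using word_mem by (auto simp: word_memory_def sim_def mem_def)
  have \<alpha>: "\<alpha> q \<in> Z q" for q
    using outcomesI[OF word_sim] by (auto simp: \<alpha>_def Z_def)
  have kX: "kk X = k" "X \<in> bitvecs n" if "X \<in> \<X>" for X
    using that X0 by (auto simp: \<X>_def key_def k_def)
  have kK: "k < K"
    using kA kX X0 by blast
  have V: "V X \<in> \<V>" if "X \<in> \<X>" for X
  proof -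
    have "card (V X) \<le> card (hits k X)"
      unfolding V_def using fin_hits by (intro card_mono) auto
    also have "\<dots> \<le> e (Suc k) * u"
      using card_hits kX[OF that] kK by blast
    also have "\<dots> \<le> n * u"
      using e_le[of "Suc k"] kK by (intro mult_le_mono1) simp
    finally show ?thesis
      by (simp add: \<V>_def V_def)
  qed
  have sim_eq: "sim x = mem X x" if X: "X \<in> \<X>" and x: "x \<in> R" "x \<notin> V X" for X x
  proof -
    have "key X = key X0"
      using X X0 by (simp add: \<X>_def)
    then have msg: "msg X = msg X0" and pre: "take a X = take a X0"
      using kX(1)[OF X] kX(1)[OF X0] by (simp_all add: key_def a_def)
    have "sent X = fst ` msg X" for X
      by (simp add: msg_def image_image)
    then have sent: "sent X = sent X0"
      using msg by simp
    show ?thesis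
    proof (cases "x \<in> sent X0")
      case True
      then have "(x, mem X x) \<in> msg X0"
        using msg sent by (force simp: msg_def)
      then show ?thesis
        using True by (auto simp: msg_def sim_def)
    next
      case False
      then have "x \<notin> later k X" "x \<notin> hits k X"
        using x sent kX[OF X] by (auto simp: sent_def V_def)
      then have "x \<notin> written_between D S X a n"
        using e_mono[of k "Suc k"] written_between_split[of a "n - e k" n D S X]
        by (auto simp: hits_def later_def a_def)
      then have "mem X x = memory_after D S X a x"
        unfolding mem_def by (intro memory_after_unwritten) (simp_all add: a_def)
      then show ?thesis
        using False pre memory_after_prefix by (metis sim_def)
    qed
  qed
  \<comment> \<open>An answer that \<open>\<beta>\<close> does not discard is correct: a run avoiding \<open>V X\<close> sees the true memory.\<close>
  have corr: "of_bool (P q X \<inter> hits k X \<subseteq> AA X) \<le> \<beta> (V X) (\<alpha> q) * chi (S ! q) X"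
    if X: "X \<in> \<X>" and q: "q < m" for q X
  proof -
    let ?A = "query D q"
    have good: ?thesis if "probed ?A sim = P q X" "result ?A sim = ip_sign (S ! q) X"
      "probes ?A sim \<le> t" "P q X \<inter> V X = {}"
    proof -
      have "\<bar>ip_sign (S ! q) X\<bar> = 1"
        by (simp add: ip_sign_def power_abs)
      then have "\<beta> (V X) (\<alpha> q) = chi (S ! q) X"
        using that by (simp add: \<beta>_def \<alpha>_def chi_def)
      then show ?thesis
        using chi_cases[of "S ! q" X] by auto
    qed
    show ?thesis
    proof (cases "P q X \<inter> hits k X \<subseteq> AA X")
      case True
      then have dis: "P q X \<inter> V X = {}"
        by (auto simp: V_def)
      have "sim x = mem X x" if "x \<in> probed ?A (mem X)" for x
        using sim_eq[OF X, of x] that P_R[of X q] kX[OF X] q dis by (auto simp: P_def)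
      then have "probed ?A sim = probed ?A (mem X) \<and> result ?A sim = result ?A (mem X) \<and>
          probes ?A sim = probes ?A (mem X)"
        by (rule probed_cong)
      then show ?thesis
        using good dis qry[of X q] kX[OF X] q by (simp add: P_def)
    next
      case False
      show ?thesis
      proof (cases "\<beta> (V X) (\<alpha> q) = 0")
        case True
        then show ?thesis using False by simp
      next
        \<comment> \<open>Now agreement is known along the simulated run, and the congruence
          transfers it to the true memory. The uncovered query then contributes 1, which exceeds the
          required 0.\<close>
        case nz: False
        then have le: "probes ?A sim \<le> t" and dis: "probed ?A sim \<inter> V X = {}"
          by (auto simp: \<alpha>_def \<beta>_def split: if_splits)
        have "(probed ?A sim, result ?A sim) \<in> outcomes w t ?A"
          by (rule outcomesI[OF word_sim le])
        then have "probed ?A sim \<subseteq> R"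
          using q unfolding R_def by blast
        then have "mem X x = sim x" if "x \<in> probed ?A sim" for x
        proof -
          have "x \<in> R" "x \<notin> V X"
            using \<open>probed ?A sim \<subseteq> R\<close> that dis by auto
          then show ?thesis
            using sim_eq[OF X] by simp
        qed
        then have "probed ?A (mem X) = probed ?A sim \<and> result ?A (mem X) = result ?A sim \<and>
            probes ?A (mem X) = probes ?A sim"
          by (rule probed_cong)
        then show ?thesis
          using good dis qry[of X q] kX[OF X] q by (simp add: P_def)
      qed
    qed
  qed
  \<comment> \<open>Covered queries contribute at least 1 and the others at least 0, so the sum is
    at least \<open>m / (2 * L ^ h)\<close>.\<close>
  have "real m * \<eta> \<le> (\<Sum>q<m. \<beta> (V X) (\<alpha> q) * chi (S ! q) X)" if X: "X \<in> \<X>" for X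
  proof -
    let ?G = "{q. q < m \<and> P q X \<inter> hits k X \<subseteq> AA X}"
    have "m \<le> 2 * L ^ h * card ?G"
      using kA kX[OF X] by metis
    then have "real m \<le> real (2 * L ^ h * card ?G)"
      by (simp only: of_nat_le_iff)
    then have "real m * \<eta> \<le> real (2 * L ^ h * card ?G) * \<eta>"
      using \<eta>(1) by (rule mult_right_mono)
    also have "\<dots> = (2 * \<eta> * real L ^ h) * real (card ?G)"
      by simp
    also have "\<dots> \<le> 1 * real (card ?G)"
      using \<eta>(2) by (rule mult_right_mono) simp
    also have "?G = {..<m} \<inter> {q. P q X \<inter> hits k X \<subseteq> AA X}"
      by auto
    also have "1 * real (card \<dots>) = (\<Sum>q<m. of_bool (P q X \<inter> hits k X \<subseteq> AA X))"
      by simp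
    also have "\<dots> \<le> (\<Sum>q<m. \<beta> (V X) (\<alpha> q) * chi (S ! q) X)"
      using corr[OF X] by (intro sum_mono) auto
    finally show ?thesis .
  qed
  then have "(\<Sum>i<N. real m * \<eta>) \<le> (\<Sum>i<N. \<Sum>q<m. \<beta> (V (Xs i)) (\<alpha> q) * chi (S ! q) (Xs i))"
    using Xs by (intro sum_mono) auto
  also have "\<dots> = (\<Sum>q<m. \<Sum>i<N. \<beta> (V (Xs i)) (\<alpha> q) * chi (S ! q) (Xs i))"
    by (rule sum.swap)
  also have "\<dots> < real m * real N * \<eta>"
    by (rule uncor) (use Xs V kX ind \<alpha> in auto)
  finally show False
    by simp
qed

section \<open>Choice of parameters\<close>

text \<open>Write the base as 2 to the power of its own logarithm, which cancels the denominator.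
  This turns polylogarithmic losses repeated over log n / log log n rounds into a power of
  \<open>n\<close>.\<close>

lemma powr_log_ratio:
  assumes "1 < n" "0 < log 2 n" "log 2 (log 2 n) \<noteq> 0"
  shows "log 2 n powr (a * (log 2 n / log 2 (log 2 n))) = n powr a"
proof -
  have "log 2 n powr (a * (log 2 n / log 2 (log 2 n))) =
      (2 powr log 2 (log 2 n)) powr (a * (log 2 n / log 2 (log 2 n)))"
    using assms by simp
  also have "\<dots> = (2 powr log 2 n) powr a"
    using assms by (simp only: powr_powr) (simp add: mult.commute)
  also have "\<dots> = n powr a"
    using assms by simp
  finally show ?thesis .
qed

text \<open>Rounding up costs at most a factor \<open>l\<close>, hence one more in the
  exponent.\<close>

lemma power_ceiling_powr_le:
  fixes l k :: real and j :: nat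
  assumes l: "2 \<le> l" and k: "0 \<le> k" and j: "real j \<le> x"
  shows "real (nat \<lceil>l powr k\<rceil>) ^ j \<le> l powr ((k + 1) * x)"
proof -
  have 1: "1 \<le> l powr k"
    using l k by (simp add: ge_one_powr_ge_zero)
  have "real (nat \<lceil>l powr k\<rceil>) \<le> l powr k + 1"
    using 1 by linarith
  also have "\<dots> \<le> l powr k * l"
  proof -
    have "l powr k * 2 \<le> l powr k * l"
      using l by (intro mult_left_mono) auto
    then show ?thesis
      using 1 by linarith
  qed
  also have "\<dots> = l powr (k + 1)"
    using l by (simp add: powr_add)
  finally have "real (nat \<lceil>l powr k\<rceil>) \<le> l powr (k + 1)" .
  then have "real (nat \<lceil>l powr k\<rceil>) ^ j \<le> (l powr (k + 1)) ^ j"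
    by (rule power_mono) (rule of_nat_0_le_iff)
  also have "\<dots> = l powr ((k + 1) * real j)"
    using l by (simp add: powr_realpow[symmetric] powr_powr)
  also have "\<dots> \<le> l powr ((k + 1) * x)"
    using l k j by (intro powr_mono mult_left_mono) auto
  finally show ?thesis .
qed

text \<open>The asymptotic requirements are collected as inequalities at a single \<open>n\<close>.
  The constant equals \<open>\<theta> * \<sigma> / 4\<close>: one factor 2 is lost to Markov's
  inequality and one to rounding \<open>K\<close> down.\<close>

lemma probe_lower_bound_at:
  fixes c \<kappa> W \<delta> :: real and n :: nat
  defines "l \<equiv> log 2 (real n)"
  defines "y \<equiv> log 2 l"
  assumes par: "0 < c" "0 < \<kappa>" "0 < W" "0 < \<delta>" "4 * \<delta> \<le> c" "\<delta> \<le> 1 / 8"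
    and l: "4 \<le> l" "c + 2 * W + 5 \<le> l" and y: "1 \<le> y"
    and ratio: "4 * (\<kappa> + 6) \<le> l / y"
    and g: "4 * (real n powr (3 / 8) + 1 + l + l ^ 5) \<le> sqrt (real n) - 1"
    and n1: "32 * l ^ 4 < real n powr \<delta>"
    and n2: "32 * (real n powr (1 + 2 * \<delta>) * (1 + l powr (\<kappa> + 4))) \<le> real n powr (1 + 4 * \<delta>) - 1"
    and w: "real w \<le> W * l"
    and D: "solves_multiphase ip_sign n (nat \<lfloor>real n powr (1 + c)\<rfloor>) w u t D"
    and u: "real u \<le> l powr \<kappa>"
  shows "\<delta> / (8 * (\<kappa> + 6) * (\<kappa> + 7)) * (l / y)\<^sup>2 \<le> real t"
proof (rule ccontr)
  \<comment> \<open>After rounding, \<open>L\<close> is at most \<open>l powr (\<kappa> + 7)\<close>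
    and \<open>B\<close> at most \<open>l powr (\<kappa> + 6)\<close>. These choices give
    \<open>L ^ h\<close> at most \<open>n powr \<delta>\<close> and \<open>B ^ K\<close> at most
    \<open>sqrt n\<close>; \<open>g\<close> takes the other \<open>sqrt n\<close>.\<close>
  define \<theta> \<sigma> where "\<theta> = \<delta> / (\<kappa> + 7)" and "\<sigma> = 1 / (2 * (\<kappa> + 6))"
  define x where "x = l / y"
  assume "\<not> ?thesis"
  then have t: "real t < \<theta> * \<sigma> / 4 * x\<^sup>2"
    using par by (simp add: x_def[symmetric] \<theta>_def \<sigma>_def field_simps)
  define m where "m = nat \<lfloor>real n powr (1 + c)\<rfloor>"
  \<comment> \<open>The negated claim gives \<open>t \<le> l\<^sup>2\<close>, so
    \<open>w * t\<close> is of cubic order in \<open>l\<close> and the fourth power leaves room.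
    Then \<open>4 * r * h * u\<close> and \<open>4 * r * u\<close> dictate the exponents of
    \<open>L\<close> and \<open>B\<close>.\<close>
  define r where "r = nat \<lfloor>l ^ 4\<rfloor>"
  define L where "L = nat \<lceil>l powr (\<kappa> + 6)\<rceil>"
  define B where "B = nat \<lceil>l powr (\<kappa> + 5)\<rceil>"
  define h where "h = nat \<lfloor>\<theta> * x\<rfloor>"
  define K where "K = nat \<lfloor>\<sigma> * x\<rfloor>"
  define g where "g = nat \<lfloor>sqrt (real n)\<rfloor>"
  \<comment> \<open>\<open>N * \<eta>\<^sup>2\<close> is of order \<open>n powr \<delta>\<close> and
    beats \<open>r\<close>, while \<open>N\<close> stays well below \<open>g\<close> because
    \<open>\<delta> \<le> 1 / 8\<close>.\<close>
  define N where "N = nat \<lceil>real n powr (3 * \<delta>)\<rceil>"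
  define \<eta> where "\<eta> = real n powr (- \<delta>) / 2"

  have n: "1 < real n"
    using l(1) unfolding l_def by (cases "n = 0 \<or> n = 1") (auto simp: log_def)
  have \<theta>: "0 < \<theta>" "\<theta> \<le> 1" and \<sigma>: "0 < \<sigma>" "\<sigma> \<le> 1"
    using par by (simp_all add: \<theta>_def \<sigma>_def)
  have ly: "0 < x" "x \<le> l"
    using l y by (simp_all add: x_def divide_le_eq)
  have l_powr_x: "l powr (a * x) = real n powr a" for a
    unfolding x_def y_def l_def
  proof (rule powr_log_ratio[OF n])
    show "0 < log 2 (real n)"
      using l unfolding l_def by linarith
    show "log 2 (log 2 (real n)) \<noteq> 0"
      using y unfolding y_def l_def by linarith
  qed
  have two: "2 \<le> \<sigma> * x"
  proof -
    have "2 = \<sigma> * (4 * (\<kappa> + 6))"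
      using par by (simp add: \<sigma>_def field_simps)
    also have "\<dots> \<le> \<sigma> * x"
      using ratio \<sigma> unfolding x_def by (intro mult_left_mono) auto
    finally show ?thesis .
  qed
  have h: "real h \<le> \<theta> * x" "\<theta> * x \<le> real (Suc h)" "real h \<le> l"
  proof -
    have "0 \<le> \<theta> * x"
      using \<theta> ly by (intro mult_nonneg_nonneg) auto
    then show 1: "real h \<le> \<theta> * x" and "\<theta> * x \<le> real (Suc h)"
      unfolding h_def by linarith+
    have "\<theta> * x \<le> 1 * l"
      using \<theta> ly by (intro mult_mono) auto
    then show "real h \<le> l"
      using 1 by linarith
  qed
  have K: "real K \<le> \<sigma> * x" "\<sigma> * x / 2 \<le> real K" "real K \<le> l" "0 < K"
  proof -
    have f: "2 \<le> \<lfloor>\<sigma> * x\<rfloor>"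
      using two by (simp only: le_floor_iff of_int_numeral)
    then have "real K = of_int \<lfloor>\<sigma> * x\<rfloor>"
      unfolding K_def by simp
    then show 1: "real K \<le> \<sigma> * x" and "\<sigma> * x / 2 \<le> real K"
      using two of_int_floor_le[of "\<sigma> * x"] real_of_int_floor_gt_diff_one[of "\<sigma> * x"]
      by linarith+
    show "0 < K"
      using f by (simp only: K_def zero_less_nat_eq)
    have "\<sigma> * x \<le> 1 * l"
      using \<sigma> ly by (intro mult_mono) auto
    then show "real K \<le> l"
      using 1 by linarith
  qed
  have r: "real r \<le> l ^ 4" "l ^ 4 - 1 \<le> real r"
  proof -
    have "0 \<le> l ^ 4"
      by simp
    then show "real r \<le> l ^ 4" "l ^ 4 - 1 \<le> real r"
      unfolding r_def by linarith+
  qed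
  have m_ge: "real n powr (1 + 4 * \<delta>) - 1 \<le> real m"
  proof -
    have "real n powr (1 + 4 * \<delta>) \<le> real n powr (1 + c)"
      using n par by (intro powr_mono) auto
    then show ?thesis
      unfolding m_def by linarith
  qed
  have m_pos: "0 < m"
  proof -
    have "0 < 32 * (real n powr (1 + 2 * \<delta>) * (1 + l powr (\<kappa> + 4)))"
      using n by (intro mult_pos_pos add_pos_nonneg) auto
    then have "0 < real m"
      using n2 m_ge by linarith
    then show ?thesis
      by simp
  qed

  have ru: "real r * real u \<le> l powr (\<kappa> + 4)"
  proof -
    have "real r * real u \<le> l ^ 4 * l powr \<kappa>"
      using r u by (intro mult_mono) auto
    then show ?thesis
      using l by (simp add: powr_add mult.commute)
  qed
  have l_powr_Suc: "4 * l powr k \<le> l powr (k + 1)" for k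
  proof -
    have "4 * l powr k \<le> l * l powr k"
      using l by (intro mult_right_mono) auto
    then show ?thesis
      using l by (simp add: powr_add mult.commute)
  qed

  have "g * B ^ K \<le> n"
  proof -
    have "real B ^ K \<le> l powr ((\<kappa> + 5 + 1) * (\<sigma> * x))"
      unfolding B_def using l par K by (intro power_ceiling_powr_le) auto
    also have "(\<kappa> + 5 + 1) * (\<sigma> * x) = 1 / 2 * x"
      using par by (simp add: \<sigma>_def field_simps)
    also have "l powr (1 / 2 * x) = sqrt (real n)"
      unfolding l_powr_x by (simp add: powr_half_sqrt)
    finally have "real B ^ K \<le> sqrt (real n)" .
    moreover have "real g \<le> sqrt (real n)"
      unfolding g_def by simp
    ultimately have "real g * real B ^ K \<le> sqrt (real n) * sqrt (real n)"
      by (intro mult_mono) auto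
    then have "real (g * B ^ K) \<le> real n"
      by simp
    then show ?thesis
      by (simp only: of_nat_le_iff)
  qed
  moreover have "2 * t \<le> K * Suc h"
  proof -
    have "2 * real t \<le> (\<sigma> * x / 2) * (\<theta> * x)"
      using t by (simp add: power2_eq_square field_simps)
    also have "\<dots> \<le> real K * real (Suc h)"
      using K h \<theta> ly by (intro mult_mono) auto
    finally have "real (2 * t) \<le> real (K * Suc h)"
      by (simp only: of_nat_mult of_nat_numeral)
    then show ?thesis
      by (simp only: of_nat_le_iff)
  qed
  moreover have "4 * (N + K + r * h) \<le> g"
  proof -
    have "real n powr (3 * \<delta>) \<le> real n powr (3 / 8)"
      using n par by (intro powr_mono) auto
    then have "real N \<le> real n powr (3 / 8) + 1"
      unfolding N_def by (smt (verit) of_nat_nat of_int_ceiling_le_add_one powr_ge_zero zero_le_ceiling)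
    moreover have "real r * real h \<le> l ^ 4 * l"
      using r h by (intro mult_mono) auto
    then have "real r * real h \<le> l ^ 5"
      by (simp add: eval_nat_numeral mult_ac)
    moreover have "sqrt (real n) - 1 \<le> real g"
      unfolding g_def by linarith
    ultimately have "4 * (real N + real K + real r * real h) \<le> real g"
      using K(3) g by argo
    then have "real (4 * (N + K + r * h)) \<le> real g"
      by simp
    then show ?thesis
      by (simp only: of_nat_le_iff)
  qed
  moreover have "4 * r * h * u \<le> L"
  proof -
    have "real h * (real r * real u) \<le> l * l powr (\<kappa> + 4)"
      using h ru l by (intro mult_mono) auto
    also have "\<dots> = l powr (\<kappa> + 5)"
      using l powr_add[of l "\<kappa> + 4" 1] by (simp add: mult.commute add.assoc)
    finally have "4 * (real h * (real r * real u)) \<le> l powr (\<kappa> + 5 + 1)"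
      using l_powr_Suc[of "\<kappa> + 5"] by linarith
    also have "l powr (\<kappa> + 5 + 1) = l powr (\<kappa> + 6)"
      by (rule arg_cong[where f = "\<lambda>z. l powr z"]) simp
    also have "\<dots> \<le> real L"
      unfolding L_def by (rule real_nat_ceiling_ge)
    finally have "real (4 * r * h * u) \<le> real L"
      by (simp add: mult_ac)
    then show ?thesis
      by (simp only: of_nat_le_iff)
  qed
  moreover have "4 * r * u \<le> B"
  proof -
    have "4 * (real r * real u) \<le> l powr (\<kappa> + 4 + 1)"
      using l_powr_Suc[of "\<kappa> + 4"] ru by linarith
    also have "l powr (\<kappa> + 4 + 1) = l powr (\<kappa> + 5)"
      by (rule arg_cong[where f = "\<lambda>z. l powr z"]) simp
    also have "\<dots> \<le> real B"
      unfolding B_def by (rule real_nat_ceiling_ge)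
    finally have "real (4 * r * u) \<le> real B"
      by (simp add: mult_ac)
    then show ?thesis
      by (simp only: of_nat_le_iff)
  qed
  moreover have "2 * \<eta> * real L ^ h \<le> 1"
  proof -
    have "real L ^ h \<le> l powr ((\<kappa> + 6 + 1) * (\<theta> * x))"
      unfolding L_def using l par h by (intro power_ceiling_powr_le) auto
    also have "(\<kappa> + 6 + 1) * (\<theta> * x) = \<delta> * x"
      using par by (simp add: \<theta>_def field_simps)
    also have "l powr (\<delta> * x) = real n powr \<delta>"
      by (rule l_powr_x)
    finally have "real n powr (- \<delta>) * real L ^ h \<le> real n powr (- \<delta>) * real n powr \<delta>"
      by (intro mult_left_mono) auto
    also have "\<dots> = 1"
      using n by (simp add: powr_add[symmetric])
    finally show ?thesis
      by (simp add: \<eta>_def)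
  qed
  moreover have "real (n * N * (1 + r * u) + r * m) < real m * real N * \<eta>\<^sup>2 / 4"
  proof -
    define v where "v = real n powr (- 2 * \<delta>)"
    have v: "0 < v" "\<eta>\<^sup>2 = v / 4"
      using n by (simp_all add: v_def \<eta>_def power_divide power2_eq_square powr_add[symmetric])
    have N: "real n powr (3 * \<delta>) \<le> real N"
      unfolding N_def by simp
    have "32 * real r < real n powr \<delta>"
      using r n1 by linarith
    also have "real n powr \<delta> = real n powr (3 * \<delta>) * v"
      using n by (simp add: v_def powr_add[symmetric])
    also have "\<dots> \<le> real N * v"
      using N v by (intro mult_right_mono) auto
    finally have "32 * real r * real m < real N * v * real m"
      using m_pos by (intro mult_strict_right_mono) auto
    then have 1: "real r * real m < real m * real N * v / 32"
      by (simp add: mult_ac)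
    have "32 * (real n * (1 + real r * real u)) = 32 * (real n powr (1 + 2 * \<delta>) * (1 + real r * real u)) * v"
      using n by (simp add: v_def powr_add[symmetric] mult_ac)
    also have "\<dots> \<le> 32 * (real n powr (1 + 2 * \<delta>) * (1 + l powr (\<kappa> + 4))) * v"
      using ru v by (intro mult_right_mono mult_left_mono) auto
    also have "\<dots> \<le> real m * v"
      using n2 m_ge v by (intro mult_right_mono) auto
    finally have "32 * (real n * (1 + real r * real u)) * real N \<le> real m * v * real N"
      by (intro mult_right_mono) auto
    then have 2: "real n * real N * (1 + real r * real u) \<le> real m * real N * v / 32"
      by (simp add: mult_ac)
    have "real (n * N * (1 + r * u) + r * m) = real n * real N * (1 + real r * real u) + real r * real m"
      by (simp add: distrib_left)
    also have "\<dots> < real m * real N * v / 16"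
      using 1 2 by linarith
    finally show ?thesis
      by (simp add: v(2))
  qed
  moreover have exponent: "nat \<lceil>(1 + c) * l\<rceil> + w * t + t + w + 1 \<le> r"
  proof -
    have "x\<^sup>2 \<le> l\<^sup>2"
      using ly by (intro power_mono) auto
    moreover have "\<theta> * \<sigma> / 4 \<le> 1"
      using \<theta> \<sigma> mult_mono[of \<theta> 1 \<sigma> 1] by simp
    ultimately have "\<theta> * \<sigma> / 4 * x\<^sup>2 \<le> 1 * l\<^sup>2"
      using \<theta> \<sigma> by (intro mult_mono) auto
    then have t2: "real t \<le> l\<^sup>2"
      using t by linarith
    have wt: "real w * real t \<le> W * l * l\<^sup>2"
      using w t2 par l by (intro mult_mono) auto
    have p: "1 \<le> l ^ 3" "l \<le> l ^ 3" "l\<^sup>2 \<le> l ^ 3"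
      using l power_increasing[of 1 3 l] power_increasing[of 2 3 l] by (auto intro: one_le_power)
    have "(1 + c) * l \<le> (1 + c) * l ^ 3" "W * l \<le> W * l ^ 3"
      using p par by (auto intro!: mult_left_mono)
    moreover have "W * l * l\<^sup>2 = W * l ^ 3"
      by (simp add: power2_eq_square power3_eq_cube)
    moreover have "real (nat \<lceil>(1 + c) * l\<rceil>) \<le> (1 + c) * l + 1"
      using par l by (simp add: of_nat_nat)
    ultimately have "real (nat \<lceil>(1 + c) * l\<rceil>) + real w * real t + real t + real w + 2
        \<le> (1 + c) * l ^ 3 + W * l ^ 3 + l ^ 3 + W * l ^ 3 + 3 * l ^ 3"
      using wt t2 w p by linarith
    also have "\<dots> = (c + 2 * W + 5) * l ^ 3"
      by (simp add: algebra_simps)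
    also have "\<dots> \<le> l * l ^ 3"
      using l by (intro mult_right_mono) auto
    also have "\<dots> = l ^ 4"
      by (simp add: eval_nat_numeral)
    finally have "real (nat \<lceil>(1 + c) * l\<rceil> + w * t + t + w + 1) \<le> real r"
      using r by simp
    then show ?thesis
      by (simp only: of_nat_le_iff)
  qed
  moreover have "m * 2 ^ (w * t) * t * 2 ^ w + 1 \<le> 2 ^ r"
  proof -
    let ?M = "nat \<lceil>(1 + c) * l\<rceil>"
    have "real m \<le> real n powr (1 + c)"
      unfolding m_def by simp
    also have "\<dots> = 2 powr ((1 + c) * l)"
      using n unfolding l_def by (simp add: powr_powr[symmetric] mult.commute[of "1 + c"])
    also have "\<dots> \<le> 2 powr real ?M"
      by (intro powr_mono real_nat_ceiling_ge) auto
    finally have "real m \<le> real (2 ^ ?M)"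
      by (simp add: powr_realpow)
    then have "m \<le> 2 ^ ?M"
      by (simp only: of_nat_le_iff)
    then have "m * 2 ^ (w * t) * t * 2 ^ w \<le> 2 ^ ?M * 2 ^ (w * t) * 2 ^ t * 2 ^ w"
      by (intro mult_mono) (auto intro: less_imp_le)
    also have "\<dots> = 2 ^ (?M + w * t + t + w)"
      by (simp add: power_add)
    finally have "m * 2 ^ (w * t) * t * 2 ^ w + 1 \<le> 2 ^ (?M + w * t + t + w) + 2 ^ (?M + w * t + t + w)"
      by (intro add_mono) auto
    also have "\<dots> = 2 ^ (?M + w * t + t + w + 1)"
      by simp
    also have "\<dots> \<le> 2 ^ r"
      using exponent by (intro power_increasing) auto
    finally show ?thesis .
  qed
  moreover have "2 ^ (w * t) + 1 \<le> (2::nat) ^ r"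
  proof -
    have "(2::nat) ^ (w * t) + 1 \<le> 2 ^ (w * t) + 2 ^ (w * t)"
      by simp
    also have "\<dots> = 2 ^ (w * t + 1)"
      by simp
    also have "\<dots> \<le> 2 ^ r"
      using exponent by (intro power_increasing) auto
    finally show ?thesis .
  qed
  moreover have "0 < L" "0 < B"
    using l by (simp_all add: L_def B_def)
  moreover have "0 \<le> \<eta>"
    by (simp add: \<eta>_def)
  ultimately show False
    using D m_pos K(4) unfolding m_def[symmetric]
    by (intro no_multiphase_ds[of n m w u t D K L B g h N r \<eta>]) auto
qed

theorem theorem1:
  fixes c \<kappa> :: real and w :: "nat \<Rightarrow> nat"
  assumes "c > 0" and "\<kappa> > 0"
    and "(\<lambda>n. real (w n)) \<in> \<Theta>(\<lambda>n. log 2 (real n))"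
  shows "\<exists>C>0. \<forall>\<^sub>F n in sequentially.
           \<forall>(D :: multiphase_ds) (t\<^sub>u :: nat) (t\<^sub>t\<^sub>o\<^sub>t :: nat).
             solves_multiphase ip_sign n (nat \<lfloor>real n powr (1 + c)\<rfloor>) (w n) t\<^sub>u t\<^sub>t\<^sub>o\<^sub>t D \<longrightarrow>
             real t\<^sub>u \<le> (log 2 (real n)) powr \<kappa> \<longrightarrow>
             real t\<^sub>t\<^sub>o\<^sub>t \<ge> C * (log 2 (real n) / log 2 (log 2 (real n)))\<^sup>2"
proof -
  define \<delta> where "\<delta> = min c (1 / 2) / 4"
  have \<delta>: "0 < \<delta>" "4 * \<delta> \<le> c" "\<delta> \<le> 1 / 8"
    using assms(1) by (auto simp: \<delta>_def min_def)
  have "(\<lambda>n. real (w n)) \<in> O(\<lambda>n. log 2 (real n))"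
    using assms(3) by blast
  then obtain W where W: "W > 0"
    "\<forall>\<^sub>F n in sequentially. norm (real (w n)) \<le> W * norm (log 2 (real n))"
    by (elim landau_o.bigE)
  define C where "C = \<delta> / (8 * (\<kappa> + 6) * (\<kappa> + 7))"
  have "C > 0"
    using \<delta> assms(2) by (simp add: C_def)
  have "\<forall>\<^sub>F n in sequentially. 4 \<le> log 2 (real n)"
    by real_asymp
  moreover have "\<forall>\<^sub>F n in sequentially. c + 2 * W + 5 \<le> log 2 (real n)"
    by real_asymp
  moreover have "\<forall>\<^sub>F n in sequentially. 1 \<le> log 2 (log 2 (real n))"
    by real_asymp
  moreover have "\<forall>\<^sub>F n in sequentially. 4 * (\<kappa> + 6) \<le> log 2 (real n) / log 2 (log 2 (real n))"
    by real_asymp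
  moreover have "\<forall>\<^sub>F n in sequentially.
      4 * (real n powr (3 / 8) + 1 + log 2 (real n) + log 2 (real n) ^ 5) \<le> sqrt (real n) - 1"
    by real_asymp
  moreover have "\<forall>\<^sub>F n in sequentially. 32 * log 2 (real n) ^ 4 < real n powr \<delta>"
    using \<delta> by real_asymp
  moreover have "\<forall>\<^sub>F n in sequentially.
      32 * (real n powr (1 + 2 * \<delta>) * (1 + log 2 (real n) powr (\<kappa> + 4))) \<le> real n powr (1 + 4 * \<delta>) - 1"
    using \<delta> assms(2) by real_asymp
  ultimately have "\<forall>\<^sub>F n in sequentially. \<forall>(D :: multiphase_ds) (t\<^sub>u :: nat) (t\<^sub>t\<^sub>o\<^sub>t :: nat).
      solves_multiphase ip_sign n (nat \<lfloor>real n powr (1 + c)\<rfloor>) (w n) t\<^sub>u t\<^sub>t\<^sub>o\<^sub>t D \<longrightarrow>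
      real t\<^sub>u \<le> (log 2 (real n)) powr \<kappa> \<longrightarrow>
      real t\<^sub>t\<^sub>o\<^sub>t \<ge> C * (log 2 (real n) / log 2 (log 2 (real n)))\<^sup>2"
    using W(2)
  proof eventually_elim
    case (elim n)
    have "real (w n) \<le> W * log 2 (real n)"
      using elim by simp
    then show ?case
      unfolding C_def using probe_lower_bound_at[of c \<kappa> W \<delta> n "w n"] assms(1,2) W(1) \<delta> elim by blast
  qed
  with \<open>C > 0\<close> show ?thesis
    by blast
qed

end
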